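(* Let $\Omega=\mathbb{R}^3$ or $\mathbb{T}^3$ and let $u$ be a K41-function on $[T_0,T_1]$ with inertial range $[K_-,K_+]$, spectral Reynolds number $\Re$ and spectral precision $\gamma$ (see context). Then the function $\alpha(K)=\dfrac{\bar E^\ast(K)}{\bar\varepsilon^{2/3}K^{-5/3}}$ satisfies $$\forall K,K'\in[K_-,K_+],\qquad \Re^{-3\gamma/4}\le\frac{\alpha(K)}{\alpha(K')}\le\Re^{3\gamma/4}.$$ (On $\mathbb{T}^3$, $\bar E^\ast$ means $\bar E^\dagger$ and $K,K'$ range over $\Sigma^\ast\cap[K_-,K_+]$.)
   Context: $\Omega$ is $\mathbb{R}^3$ or $\mathbb{T}^3=\mathbb{R}^3/(L\mathbb{Z})^3$; $\nu>0$. The Leray space is $\mathcal{L}(\Omega)=L^\infty(\mathbb{R}_+;L^2(\Omega))\cap L^2(\mathbb{R}_+;\dot H^1(\Omega))$; vector fields are divergence-free. $\rho=1$ on $\mathbb{R}^3$, $\rho=L^{-3}$ on $\mathbb{T}^3$; $\varepsilon(t)=2\rho\nu\|\nabla u(t)\|_{L^2}^2$. Time averages: $\bar f=\langle f\rangle=\frac1{T_1-T_0}\int_{T_0}^{T_1}f\,dt$. **Spectrum.** $\hat u(t,\xi)=\int_\Omega e^{-ix\cdot\xi}u(t,x)dx$. On $\mathbb{R}^3$: $\Sigma=[0,\infty)$, $\mu$ = Lebesgue measure, $E^\dagger(K,t)=(2\pi)^{-3}\rho K^2\int_{\mathbb{S}^2}|\hat u(t,K\vartheta)|^2d\vartheta$,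 $E^\ast(K,t)=\frac{\rho}{K}\int_{\mathbb{R}^3}\psi(|\xi|/K)|\hat u(t,\xi)|^2\frac{d\xi}{(2\pi)^3}$, with $\psi\ge0$ a fixed smooth bump function supported in $[2^{-1},2]$, $\int_0^\infty\psi(r)\frac{dr}{r}=1$. On $\mathbb{T}^3$: $\Sigma=\{|\mathbf{k}|:\mathbf{k}\in(2\pi L^{-1}\mathbb{Z})^3\}$, $\Sigma^\ast=\Sigma\setminus\{0\}$, $\mu=\frac{2\pi}{L}\sum_{K\in\Sigma^\ast}\frac{2\pi}{KL}\delta_K$, $E^\dagger(K,t)=(2\pi)^{-2}\rho\frac KL\sum_{|\mathbf{k}|=K}|\hat u(t,\mathbf{k})|^2$ for $K\in\Sigma^\ast$; there $E^\ast=E^\dagger$, and frequencies (including $K_\pm$) range over $\Sigma^\ast$. **Volume.** $\operatorname{Vol}(u;[T_0,T_1])=\langle\|u\|_{L^1(\Omega)}^2\rangle/\langle\|u\|_{L^2(\Omega)}^2\rangle$. **K41-functions.** $u\in\mathcal{L}(\Omega)$ is a K41-function on $[T_0,T_1]$ if there is $C\in]1,2[$ with $\int_\Sigma K^2\bar E^\dagger(K)d\mu(K)\le C\int_{\{K\in\Sigma:\,K\ge\operatorname{Vol}(u;[T_0,T_1])^{-1/3}\}}K^2\bar E^\dagger(K)d\mu(K)$. An inertial range is an interval $[K_-,K_+]$, $0<K_-<K_+$, such that: (i) on $\mathbb{R}^3$, $(K_-)^3\operatorname{Vol}(u;[T_0,T_1])\le1$; on $\mathbb{T}^3$, $K_-=2\pi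 L^{-1}$ if $\operatorname{Vol}(u;[T_0,T_1])\ge(2\pi)^{-3}L^3$ and $2\pi L^{-1}\le K_-\le\operatorname{Vol}(u;[T_0,T_1])^{-1/3}$ otherwise; (ii) $\int_\Sigma K^2\bar E^\ast(K)d\mu(K)\le2\int_{\Sigma\cap[K_-,K_+]}K^2\bar E^\ast(K)d\mu(K)$. Then $\Re=(K_+/K_-)^{4/3}$, and $\gamma=\sup_{K\in[K_-,K_+]}\left|K\frac{d}{dK}(\log\bar E^\ast)+\frac53\right|$ on $\mathbb{R}^3$; on $\mathbb{T}^3$, writing $\Sigma=\{K_j\}$ increasingly, $\gamma=\max_{K_-\le K_j<K_{j+1}\le K_+}\left|\frac{\log(\bar E^\dagger(K_{j+1})/\bar E^\dagger(K_j))}{\log(K_{j+1}/K_j)}+\frac53\right|$. *)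

theory Defs
  imports "HOL-Analysis.Analysis"
begin

text \<open>
  Fields on \<open>T3 L\<close>, the torus of side \<open>L\<close>, are represented by \<open>L\<close>-periodic functions on the whole
  space, integrated over the period cell.
\<close>

datatype flow_domain = R3 | T3 real

fun cell :: "flow_domain \<Rightarrow> (real^3) set" where
  "cell R3 = UNIV"
| "cell (T3 L) = cbox 0 (\<chi> i. L)"

fun rho :: "flow_domain \<Rightarrow> real" where
  "rho R3 = 1"
| "rho (T3 L) = 1 / L ^ 3"

fun on_domain :: "flow_domain \<Rightarrow> (real^3 \<Rightarrow> 'b) \<Rightarrow> bool" where
  "on_domain R3 f = True"
| "on_domain (T3 L) f = (\<forall>x i. f (x + L *\<^sub>R axis i 1) = f x)"


subsection \<open>Smooth functions and weak gradients\<close>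

primrec Ck :: "nat \<Rightarrow> ('a::euclidean_space \<Rightarrow> real) \<Rightarrow> bool" where
  "Ck 0 f = continuous_on UNIV f"
| "Ck (Suc k) f = (f differentiable_on UNIV \<and>
     (\<forall>b\<in>Basis. Ck k (\<lambda>x. frechet_derivative f (at x) b)))"

definition smooth :: "('a::euclidean_space \<Rightarrow> real) \<Rightarrow> bool" where
  "smooth f \<longleftrightarrow> (\<forall>k. Ck k f)"

definition partial :: "3 \<Rightarrow> (real^3 \<Rightarrow> real) \<Rightarrow> real^3 \<Rightarrow> real" where
  "partial j f x = frechet_derivative f (at x) (axis j 1)"

fun test_function :: "flow_domain \<Rightarrow> (real^3 \<Rightarrow> real) \<Rightarrow> bool" where
  "test_function R3 \<phi> = (smooth \<phi> \<and> compact (closure {x. \<phi> x \<noteq> 0}))"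
| "test_function (T3 L) \<phi> = (smooth \<phi> \<and> on_domain (T3 L) \<phi>)"

text \<open>
  Elements of the Leray space are classes of fields modulo null sets; they are represented by
  jointly Borel measurable functions of time and space. Only times \<open>t \<ge> 0\<close> matter.
\<close>

definition spacetime_measurable :: "(real \<Rightarrow> real^3 \<Rightarrow> 'b::real_normed_vector) \<Rightarrow> bool" where
  "spacetime_measurable u \<longleftrightarrow> set_borel_measurable borel ({0..} \<times> UNIV) (\<lambda>(t, x). u t x)"

text \<open>\<open>G t x $ i $ j\<close> is the derivative of the \<open>i\<close>-th component of \<open>u t\<close> in direction \<open>j\<close>.\<close>

definition weak_gradient ::
    "flow_domain \<Rightarrow> (real \<Rightarrow> real^3 \<Rightarrow> real^3) \<Rightarrow> (real \<Rightarrow> real^3 \<Rightarrow> real^3^3) \<Rightarrow> bool" where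
  "weak_gradient \<Omega> u G \<longleftrightarrow>
     spacetime_measurable G \<and> (\<forall>t\<ge>0. on_domain \<Omega> (G t)) \<and>
     (AE t in lborel. t \<ge> 0 \<longrightarrow>
        (\<forall>\<phi> i j. test_function \<Omega> \<phi> \<longrightarrow>
           set_integrable lborel (cell \<Omega>) (\<lambda>x. G t x $ i $ j * \<phi> x) \<and>
           (LINT x:cell \<Omega>|lborel. u t x $ i * partial j \<phi> x)
             = - (LINT x:cell \<Omega>|lborel. G t x $ i $ j * \<phi> x)))"

text \<open>Weak gradients are unique up to null sets, so the choice below is immaterial.\<close>

definition grad ::
    "flow_domain \<Rightarrow> (real \<Rightarrow> real^3 \<Rightarrow> real^3) \<Rightarrow> real \<Rightarrow> real^3 \<Rightarrow> real^3^3" where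
  "grad \<Omega> u = (SOME G. weak_gradient \<Omega> u G)"

definition divergence_free :: "flow_domain \<Rightarrow> (real \<Rightarrow> real^3 \<Rightarrow> real^3) \<Rightarrow> bool" where
  "divergence_free \<Omega> u \<longleftrightarrow>
     (AE t in lborel. t \<ge> 0 \<longrightarrow>
        (\<forall>\<phi>. test_function \<Omega> \<phi> \<longrightarrow>
           (LINT x:cell \<Omega>|lborel. (\<Sum>j\<in>UNIV. u t x $ j * partial j \<phi> x)) = 0))"

definition L1_norm :: "flow_domain \<Rightarrow> (real^3 \<Rightarrow> 'b::real_normed_vector) \<Rightarrow> ennreal" where
  "L1_norm \<Omega> f = (\<integral>\<^sup>+x\<in>cell \<Omega>. ennreal (norm (f x)) \<partial>lborel)"

definition L2_norm_sq :: "flow_domain \<Rightarrow> (real^3 \<Rightarrow> 'b::real_normed_vector) \<Rightarrow> ennreal" where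
  "L2_norm_sq \<Omega> f = (\<integral>\<^sup>+x\<in>cell \<Omega>. ennreal ((norm (f x))\<^sup>2) \<partial>lborel)"

definition leray_space :: "flow_domain \<Rightarrow> (real \<Rightarrow> real^3 \<Rightarrow> real^3) set" where
  "leray_space \<Omega> =
     {u. spacetime_measurable u \<and> (\<forall>t\<ge>0. on_domain \<Omega> (u t)) \<and>
         (\<exists>B::real. AE t in lborel. t \<ge> 0 \<longrightarrow> L2_norm_sq \<Omega> (u t) \<le> ennreal B) \<and>
         (\<exists>G. weak_gradient \<Omega> u G) \<and>
         (\<integral>\<^sup>+t\<in>{0..}. L2_norm_sq \<Omega> (grad \<Omega> u t) \<partial>lborel) < \<infinity> \<and>
         divergence_free \<Omega> u}"


subsection \<open>Time averages, dissipation and volume\<close>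

definition time_avg :: "real \<Rightarrow> real \<Rightarrow> (real \<Rightarrow> real) \<Rightarrow> real" where
  "time_avg T0 T1 f = (LINT t:{T0..T1}|lborel. f t) / (T1 - T0)"

definition time_avg_nn :: "real \<Rightarrow> real \<Rightarrow> (real \<Rightarrow> ennreal) \<Rightarrow> ennreal" where
  "time_avg_nn T0 T1 f = (\<integral>\<^sup>+t\<in>{T0..T1}. f t \<partial>lborel) / ennreal (T1 - T0)"

definition dissipation ::
    "flow_domain \<Rightarrow> real \<Rightarrow> (real \<Rightarrow> real^3 \<Rightarrow> real^3) \<Rightarrow> real \<Rightarrow> real" where
  "dissipation \<Omega> \<nu> u t = 2 * rho \<Omega> * \<nu> * enn2real (L2_norm_sq \<Omega> (grad \<Omega> u t))"

text \<open>The volume is infinite when \<open>u\<close> is not square integrable in time with values in \<open>L\<^sup>1\<close>.\<close>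

definition Vol ::
    "flow_domain \<Rightarrow> (real \<Rightarrow> real^3 \<Rightarrow> real^3) \<Rightarrow> real \<Rightarrow> real \<Rightarrow> ennreal" where
  "Vol \<Omega> u T0 T1 =
     time_avg_nn T0 T1 (\<lambda>t. (L1_norm \<Omega> (u t))\<^sup>2) / time_avg_nn T0 T1 (\<lambda>t. L2_norm_sq \<Omega> (u t))"

text \<open>The extended real \<open>v powr (-1/3)\<close>.\<close>

definition inv_cbrt :: "ennreal \<Rightarrow> ennreal" where
  "inv_cbrt v = (if v = 0 then \<infinity> else if v = \<infinity> then 0 else ennreal (enn2real v powr (-1/3)))"


subsection \<open>Spectrum\<close>

text \<open>
  The Fourier integral is taken literally. On \<open>R3\<close> it is meaningful at almost every time of
  \<open>[T0, T1]\<close> as soon as \<open>Vol\<close> is finite, which every inertial range enforces.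
\<close>

definition fourier :: "flow_domain \<Rightarrow> (real^3 \<Rightarrow> real^3) \<Rightarrow> real^3 \<Rightarrow> complex^3" where
  "fourier \<Omega> f \<xi> =
     (\<chi> i. LINT x:cell \<Omega>|lborel. exp (- (\<i> * complex_of_real (x \<bullet> \<xi>))) * complex_of_real (f x $ i))"

definition dual_lattice :: "real \<Rightarrow> (real^3) set" where
  "dual_lattice L = {k. \<forall>i. \<exists>n::int. k $ i = 2 * pi / L * of_int n}"

text \<open>The nonzero frequencies.\<close>

fun freqs :: "flow_domain \<Rightarrow> real set" where
  "freqs R3 = {0<..}"
| "freqs (T3 L) = norm ` dual_lattice L - {0}"

text \<open>On \<open>T3 L\<close> the spectral measure does not charge \<open>0\<close>, which is therefore left out of its space.\<close>

fun spec_measure :: "flow_domain \<Rightarrow> real measure" where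
  "spec_measure R3 = restrict_space lborel {0..}"
| "spec_measure (T3 L) =
     density (count_space (freqs (T3 L))) (\<lambda>K. ennreal (2 * pi / L * (2 * pi / (K * L))))"

text \<open>The integral over the unit sphere with respect to surface area, in spherical coordinates.\<close>

definition sphere_integral :: "(real^3 \<Rightarrow> real) \<Rightarrow> real" where
  "sphere_integral f =
     (LINT \<phi>:{0..2*pi}|lborel. LINT \<theta>:{0..pi}|lborel.
        f (vector [sin \<theta> * cos \<phi>, sin \<theta> * sin \<phi>, cos \<theta>]) * sin \<theta>)"

fun E_dagger ::
    "flow_domain \<Rightarrow> (real \<Rightarrow> real^3 \<Rightarrow> real^3) \<Rightarrow> real \<Rightarrow> real \<Rightarrow> real" where
  "E_dagger R3 u K t =
     1 / (2 * pi) ^ 3 * rho R3 * K\<^sup>2 *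
       sphere_integral (\<lambda>\<theta>. (norm (fourier R3 (u t) (K *\<^sub>R \<theta>)))\<^sup>2)"
| "E_dagger (T3 L) u K t =
     1 / (2 * pi)\<^sup>2 * rho (T3 L) * (K / L) *
       (\<Sum>k\<in>{k \<in> dual_lattice L. norm k = K}. (norm (fourier (T3 L) (u t) k))\<^sup>2)"

definition bump :: "(real \<Rightarrow> real) \<Rightarrow> bool" where
  "bump \<psi> \<longleftrightarrow>
     smooth \<psi> \<and> (\<forall>r. \<psi> r \<ge> 0) \<and> (\<forall>r. r \<notin> {1/2..2} \<longrightarrow> \<psi> r = 0) \<and>
     (LINT r:{0<..}|lborel. \<psi> r / r) = 1"

fun E_star ::
    "flow_domain \<Rightarrow> (real \<Rightarrow> real) \<Rightarrow> (real \<Rightarrow> real^3 \<Rightarrow> real^3) \<Rightarrow> real \<Rightarrow> real \<Rightarrow> real" where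
  "E_star R3 \<psi> u K t =
     rho R3 / K *
       (LINT \<xi>|lborel. \<psi> (norm \<xi> / K) * (norm (fourier R3 (u t) \<xi>))\<^sup>2 / (2 * pi) ^ 3)"
| "E_star (T3 L) \<psi> u K t = E_dagger (T3 L) u K t"

definition E_dagger_avg ::
    "flow_domain \<Rightarrow> (real \<Rightarrow> real^3 \<Rightarrow> real^3) \<Rightarrow> real \<Rightarrow> real \<Rightarrow> real \<Rightarrow> real" where
  "E_dagger_avg \<Omega> u T0 T1 K = time_avg T0 T1 (E_dagger \<Omega> u K)"

definition E_star_avg ::
    "flow_domain \<Rightarrow> (real \<Rightarrow> real) \<Rightarrow> (real \<Rightarrow> real^3 \<Rightarrow> real^3) \<Rightarrow> real \<Rightarrow> real \<Rightarrow> real \<Rightarrow> real" where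
  "E_star_avg \<Omega> \<psi> u T0 T1 K = time_avg T0 T1 (E_star \<Omega> \<psi> u K)"


subsection \<open>K41-functions\<close>

definition K41_function ::
    "flow_domain \<Rightarrow> (real \<Rightarrow> real^3 \<Rightarrow> real^3) \<Rightarrow> real \<Rightarrow> real \<Rightarrow> bool" where
  "K41_function \<Omega> u T0 T1 \<longleftrightarrow>
     u \<in> leray_space \<Omega> \<and>
     (\<exists>C::real. 1 < C \<and> C < 2 \<and>
        (\<integral>\<^sup>+K. ennreal (K\<^sup>2 * E_dagger_avg \<Omega> u T0 T1 K) \<partial>spec_measure \<Omega>)
          \<le> ennreal C *
            (\<integral>\<^sup>+K\<in>{K. ennreal K \<ge> inv_cbrt (Vol \<Omega> u T0 T1)}.
               ennreal (K\<^sup>2 * E_dagger_avg \<Omega> u T0 T1 K) \<partial>spec_measure \<Omega>))"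

fun lower_end_ok :: "flow_domain \<Rightarrow> ennreal \<Rightarrow> real \<Rightarrow> bool" where
  "lower_end_ok R3 V Km = (ennreal (Km ^ 3) * V \<le> 1)"
| "lower_end_ok (T3 L) V Km =
     (if V \<ge> ennreal (L ^ 3 / (2 * pi) ^ 3) then Km = 2 * pi / L
      else 2 * pi / L \<le> Km \<and> ennreal Km \<le> inv_cbrt V)"

definition inertial_range ::
    "flow_domain \<Rightarrow> (real \<Rightarrow> real) \<Rightarrow> (real \<Rightarrow> real^3 \<Rightarrow> real^3) \<Rightarrow> real \<Rightarrow> real
      \<Rightarrow> real \<Rightarrow> real \<Rightarrow> bool" where
  "inertial_range \<Omega> \<psi> u T0 T1 Km Kp \<longleftrightarrow>
     Km \<in> freqs \<Omega> \<and> Kp \<in> freqs \<Omega> \<and> 0 < Km \<and> Km < Kp \<and>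
     lower_end_ok \<Omega> (Vol \<Omega> u T0 T1) Km \<and>
     (\<integral>\<^sup>+K. ennreal (K\<^sup>2 * E_star_avg \<Omega> \<psi> u T0 T1 K) \<partial>spec_measure \<Omega>)
       \<le> 2 * (\<integral>\<^sup>+K\<in>{Km..Kp}. ennreal (K\<^sup>2 * E_star_avg \<Omega> \<psi> u T0 T1 K) \<partial>spec_measure \<Omega>)"

definition spectral_reynolds :: "real \<Rightarrow> real \<Rightarrow> real" where
  "spectral_reynolds Km Kp = (Kp / Km) powr (4/3)"

text \<open>
  The spectral precision is infinite when the averaged spectrum vanishes somewhere in the range,
  where its logarithm is \<open>-\<infinity>\<close>. On \<open>T3 L\<close> the supremum runs over consecutive
  frequencies, finitely many in each bounded range, and is thus a maximum.
\<close>

fun spectral_precision ::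
    "flow_domain \<Rightarrow> (real \<Rightarrow> real) \<Rightarrow> (real \<Rightarrow> real^3 \<Rightarrow> real^3) \<Rightarrow> real \<Rightarrow> real
      \<Rightarrow> real \<Rightarrow> real \<Rightarrow> ereal" where
  "spectral_precision R3 \<psi> u T0 T1 Km Kp =
     (SUP K\<in>{Km..Kp}.
        if E_star_avg R3 \<psi> u T0 T1 K > 0
        then ereal \<bar>K * deriv (\<lambda>k. ln (E_star_avg R3 \<psi> u T0 T1 k)) K + 5/3\<bar>
        else \<infinity>)"
| "spectral_precision (T3 L) \<psi> u T0 T1 Km Kp =
     (SUP (K, K')\<in>{(K, K'). K \<in> freqs (T3 L) \<and> K' \<in> freqs (T3 L) \<and>
                    Km \<le> K \<and> K < K' \<and> K' \<le> Kp \<and> freqs (T3 L) \<inter> {K<..<K'} = {}}.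
        if E_dagger_avg (T3 L) u T0 T1 K > 0 \<and> E_dagger_avg (T3 L) u T0 T1 K' > 0
        then ereal \<bar>ln (E_dagger_avg (T3 L) u T0 T1 K' / E_dagger_avg (T3 L) u T0 T1 K)
                     / ln (K' / K) + 5/3\<bar>
        else \<infinity>)"

definition alpha ::
    "flow_domain \<Rightarrow> real \<Rightarrow> (real \<Rightarrow> real) \<Rightarrow> (real \<Rightarrow> real^3 \<Rightarrow> real^3) \<Rightarrow> real \<Rightarrow> real
      \<Rightarrow> real \<Rightarrow> real" where
  "alpha \<Omega> \<nu> \<psi> u T0 T1 K =
     E_star_avg \<Omega> \<psi> u T0 T1 K
       / (time_avg T0 T1 (dissipation \<Omega> \<nu> u) powr (2/3) * K powr (-5/3))"

end

theory Submission
  imports Defs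
begin

text \<open>
  Put \<open>f K = ln (E K) + 5/3 ln K\<close> for the averaged spectrum \<open>E\<close>, so that the ratio of two values
  of \<open>\<alpha>\<close> is the exponential of a difference of values of \<open>f\<close>, while \<open>\<Re>\<close> raised to \<open>3 \<gamma> / 4\<close>
  is \<open>exp (\<gamma> (ln Kp - ln Km))\<close>. It suffices that \<open>f\<close> is \<open>\<gamma>\<close>-Lipschitz in \<open>ln K\<close>: this is the mean
  value theorem on the whole space, and a sum over consecutive frequencies on the torus.

  Two points are not mere calculus. First, \<open>deriv\<close> says nothing at points of nondifferentiability, so
  the averaged spectrum on the whole space must be shown to be differentiable. The lower end of the
  inertial range makes the volume finite, hence the Fourier transform is bounded by the \<open>L\<^sup>1\<close> norm,
  whose square is integrable in time, and one may differentiate under both integrals. Second,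
  \<open>\<alpha>\<close> is identically \<open>0\<close> if the mean dissipation vanishes. In that case almost all \<open>u t\<close> have a
  vanishing weak gradient; testing it against (truncated) plane waves shows that their Fourier
  transforms vanish at every nonzero frequency, which contradicts \<open>E > 0\<close>.
\<close>

subsection \<open>Smooth functions\<close>

text \<open>Derivatives are unique, so any explicitly known derivative may replace the chosen
  \<open>frechet_derivative\<close> in the definition of \<open>Ck\<close>.\<close>

lemma Ck_SucI:
  assumes "\<And>x. (f has_derivative f' x) (at x)" "\<And>b. b \<in> Basis \<Longrightarrow> Ck k (\<lambda>x. f' x b)"
  shows "Ck (Suc k) f"
proof -
  have "frechet_derivative f (at x) = f' x" for x
    using assms(1) by (metis frechet_derivative_at)
  then show ?thesis
    using assms by (auto simp: differentiable_on_def intro: differentiableI)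
qed

lemma Ck_SucD:
  assumes "Ck (Suc k) f"
  shows "(f has_derivative frechet_derivative f (at x)) (at x)"
    and "b \<in> Basis \<Longrightarrow> Ck k (\<lambda>x. frechet_derivative f (at x) b)"
  using assms by (auto simp: differentiable_on_def frechet_derivative_works)

lemma Ck_Suc_imp_Ck: "Ck (Suc k) f \<Longrightarrow> Ck k f"
proof (induction k arbitrary: f)
  case 0
  then show ?case
    by (auto intro: differentiable_imp_continuous_on)
next
  case (Suc k)
  then show ?case
    using Ck.simps(2) by blast
qed

lemma Ck_const: "Ck k (\<lambda>_. c)"
  by (induction k arbitrary: c) (auto intro!: Ck_SucI[where f' = "\<lambda>_ _. 0"] simp del: Ck.simps(2))

lemma Ck_add: "Ck k f \<Longrightarrow> Ck k g \<Longrightarrow> Ck k (\<lambda>x. f x + g x)"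
proof (induction k arbitrary: f g)
  case (Suc k)
  show ?case
    by (rule Ck_SucI[OF has_derivative_add[OF Suc.prems[THEN Ck_SucD(1)]]])
      (intro Suc.IH Suc.prems[THEN Ck_SucD(2)])
qed (auto intro!: continuous_intros)

lemma Ck_sum: "(\<And>i. i \<in> I \<Longrightarrow> Ck k (f i)) \<Longrightarrow> Ck k (\<lambda>x. \<Sum>i\<in>I. f i x)"
  by (induction I rule: infinite_finite_induct) (auto intro: Ck_add Ck_const)

lemma Ck_mult: "Ck k f \<Longrightarrow> Ck k g \<Longrightarrow> Ck k (\<lambda>x. f x * g x)"
proof (induction k arbitrary: f g)
  case (Suc k)
  show ?case
    by (rule Ck_SucI[OF has_derivative_mult[OF Suc.prems[THEN Ck_SucD(1)]]])
      (intro Ck_add Suc.IH Suc.prems[THEN Ck_SucD(2)] Suc.prems[THEN Ck_Suc_imp_Ck])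
qed (auto intro!: continuous_intros)

text \<open>Induction through the chain rule: the directional derivatives of the composite are again
  derivatives of \<open>f\<close> at affine arguments, one order lower. Dilations, coordinate
  projections and inner products are all covered.\<close>

lemma Ck_compose_affine:
  fixes f :: "'a::euclidean_space \<Rightarrow> real" and l :: "'b::euclidean_space \<Rightarrow> 'a"
  assumes "bounded_linear l"
  shows "Ck k f \<Longrightarrow> Ck k (\<lambda>x. f (l x + c))"
proof (induction k arbitrary: f)
  case 0
  have "continuous_on UNIV (\<lambda>x. l x + c)"
    by (intro continuous_on_add continuous_on_const linear_continuous_on assms)
  from continuous_on_compose2[OF _ this, of UNIV f] 0 show ?case
    by simp
next
  case (Suc k)
  let ?D = "\<lambda>y. frechet_derivative f (at y)"
  note D = Ck_SucD[OF Suc.prems]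
  \<comment> \<open>The direction \<open>l b\<close> need not be a basis vector, while
    \<open>Ck\<close> controls only derivatives along \<open>Basis\<close>. The expansion has
    coefficients independent of the point.\<close>
  have lin: "?D y v = (\<Sum>b\<in>Basis. (v \<bullet> b) * ?D y b)" for y v
  proof -
    interpret bounded_linear "?D y"
      using D(1) has_derivative_bounded_linear by blast
    have "?D y v = ?D y (\<Sum>b\<in>Basis. (v \<bullet> b) *\<^sub>R b)"
      by (simp add: euclidean_representation)
    then show ?thesis
      by (simp add: sum scaleR)
  qed
  show ?case
  proof (rule Ck_SucI)
    fix x
    have "((\<lambda>x. l x + c) has_derivative l) (at x)"
      by (auto intro!: derivative_eq_intros bounded_linear_imp_has_derivative assms)
    from has_derivative_compose[OF this D(1)]
    show "((\<lambda>x. f (l x + c)) has_derivative (\<lambda>h. ?D (l x + c) (l h))) (at x)" .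
  next
    fix b :: 'b
    show "Ck k (\<lambda>x. ?D (l x + c) (l b))"
      by (subst lin) (intro Ck_sum Ck_mult Ck_const Suc.IH D(2))
  qed
qed

text \<open>Differentiation exchanges the two functions, so neither induction closes without the
  other.\<close>

lemma Ck_sin_cos: "Ck k (sin :: real \<Rightarrow> real) \<and> Ck k (cos :: real \<Rightarrow> real)"
proof (induction k)
  case (Suc k)
  have "Ck (Suc k) (sin :: real \<Rightarrow> real)"
    by (rule Ck_SucI[where f' = "\<lambda>x h. cos x * h"])
      (use Suc in \<open>auto intro!: derivative_eq_intros Ck_mult Ck_const\<close>)
  moreover have "Ck (Suc k) (cos :: real \<Rightarrow> real)"
    by (rule Ck_SucI[where f' = "\<lambda>x h. (-1) * sin x * h"])
      (use Suc Ck_mult[OF Ck_const[of k "-1"], of sin] in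
        \<open>auto intro!: derivative_eq_intros Ck_mult Ck_const\<close>)
  ultimately show ?case ..
qed (auto intro!: continuous_intros)

lemma smooth_mult: "smooth f \<Longrightarrow> smooth g \<Longrightarrow> smooth (\<lambda>x. f x * g x)"
  by (auto simp: smooth_def Ck_mult)

lemma smooth_const: "smooth (\<lambda>_. c)"
  by (auto simp: smooth_def Ck_const)

lemma smooth_compose_affine:
  fixes f :: "'a::euclidean_space \<Rightarrow> real" and l :: "'b::euclidean_space \<Rightarrow> 'a"
  shows "smooth f \<Longrightarrow> bounded_linear l \<Longrightarrow> smooth (\<lambda>x. f (l x + c))"
  by (auto simp: smooth_def Ck_compose_affine)

lemma smooth_cos_inner: "smooth (\<lambda>x. cos (x \<bullet> k))"
  and smooth_sin_inner: "smooth (\<lambda>x. sin (x \<bullet> k))"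
  using smooth_compose_affine[OF _ bounded_linear_inner_left, of cos k 0]
    smooth_compose_affine[OF _ bounded_linear_inner_left, of sin k 0] Ck_sin_cos
  by (auto simp: smooth_def)

lemma smooth_has_derivative: "smooth f \<Longrightarrow> (f has_derivative frechet_derivative f (at x)) (at x)"
  using Ck_SucD(1) unfolding smooth_def by blast

lemma continuous_on_smooth: "smooth f \<Longrightarrow> continuous_on UNIV f"
  using Ck.simps(1) unfolding smooth_def by blast

lemma continuous_on_partial: "smooth f \<Longrightarrow> continuous_on UNIV (partial j f)"
  using Ck_SucD(2)[of 0 f "axis j 1"] unfolding smooth_def partial_def
  by (auto simp: axis_in_Basis_iff)

lemma has_derivative_partial: "(f has_derivative f') (at x) \<Longrightarrow> partial j f x = f' (axis j 1)"
  unfolding partial_def by (metis frechet_derivative_at)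

lemma partial_mult:
  assumes "smooth f" "smooth g"
  shows "partial j (\<lambda>x. f x * g x) x = f x * partial j g x + partial j f x * g x"
  by (subst has_derivative_partial[OF has_derivative_mult[OF assms[THEN smooth_has_derivative]]])
    (simp add: partial_def)

lemma partial_cos_inner: "partial j (\<lambda>x. cos (x \<bullet> k)) x = - (k $ j) * sin (x \<bullet> k)"
proof -
  have "((\<lambda>x. cos (x \<bullet> k)) has_derivative (\<lambda>h. - (h \<bullet> k * sin (x \<bullet> k)))) (at x)"
    by (auto intro!: derivative_eq_intros)
  from has_derivative_partial[OF this] show ?thesis
    by (simp add: inner_axis')
qed

lemma partial_sin_inner: "partial j (\<lambda>x. sin (x \<bullet> k)) x = k $ j * cos (x \<bullet> k)"
proof -
  have "((\<lambda>x. sin (x \<bullet> k)) has_derivative (\<lambda>h. h \<bullet> k * cos (x \<bullet> k))) (at x)"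
    by (auto intro!: derivative_eq_intros)
  from has_derivative_partial[OF this] show ?thesis
    by (simp add: inner_axis')
qed

lemma partial_scaleR:
  assumes "smooth f"
  shows "partial j (\<lambda>x. f (c *\<^sub>R x)) x = c * partial j f (c *\<^sub>R x)"
proof -
  have "((\<lambda>x. c *\<^sub>R x) has_derivative (\<lambda>x. c *\<^sub>R x)) (at x)"
    by (auto intro!: derivative_eq_intros)
  note D = has_derivative_compose[OF this smooth_has_derivative[OF assms]]
  have "linear (frechet_derivative f (at (c *\<^sub>R x)))"
    using smooth_has_derivative[OF assms] has_derivative_linear by blast
  then show ?thesis
    unfolding has_derivative_partial[OF D] by (simp add: partial_def linear_cmul)
qed

lemma bounded_range_of_bounded_support:
  fixes f :: "'a::euclidean_space \<Rightarrow> real"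
  assumes "continuous_on UNIV f" "bounded {x. f x \<noteq> 0}"
  obtains B where "\<And>x. \<bar>f x\<bar> \<le> B"
proof -
  let ?K = "closure {x. f x \<noteq> 0}"
  have "compact (f ` ?K)"
    using assms by (intro compact_continuous_image) (auto intro: continuous_on_subset)
  then obtain B where B: "\<And>x. x \<in> ?K \<Longrightarrow> \<bar>f x\<bar> \<le> B"
    by (force dest!: compact_imp_bounded simp: bounded_real)
  have "\<bar>f x\<bar> \<le> max B 0" for x
    using B[of x] closure_subset[of "{x. f x \<noteq> 0}"] by (cases "f x = 0") (auto simp: le_max_iff_disj)
  then show ?thesis ..
qed

text \<open>The function vanishes on an open neighbourhood of such a point. Hence derivatives of a
  cutoff have bounded support too, and are bounded.\<close>

lemma partial_eq_0_outside_support: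
  assumes "x \<notin> closure {x. f x \<noteq> 0}"
  shows "partial j f x = 0"
proof -
  have "((\<lambda>_. 0) has_derivative (\<lambda>_. 0)) (at x)"
    by simp
  then have "(f has_derivative (\<lambda>_. 0)) (at x)"
    by (rule has_derivative_transform_within_open[where s = "- closure {x. f x \<noteq> 0}"])
      (use assms closure_subset[of "{x. f x \<noteq> 0}"] in auto)
  then show ?thesis
    using has_derivative_partial by blast
qed

text \<open>A cutoff is manufactured from the given bump \<open>\<psi>\<close>: a product of
  translates of \<open>\<psi>\<close>, one per coordinate, has support in a box.\<close>

lemma smooth_cutoff_exists:
  assumes "bump \<psi>"
  obtains \<eta> :: "real^3 \<Rightarrow> real" where "smooth \<eta>" "bounded {x. \<eta> x \<noteq> 0}" "\<eta> 0 = 1"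
proof -
  have sm: "smooth \<psi>" and supp: "\<And>r. r \<notin> {1/2..2} \<Longrightarrow> \<psi> r = 0"
    using assms by (auto simp: bump_def)
  \<comment> \<open>If \<open>\<psi>\<close> vanished identically, its normalising integral would be
    0 instead of 1. Translating by \<open>a\<close> brings a nonzero value to the origin, and
    dividing by \<open>\<psi> a ^ 3\<close> turns it into 1.\<close>
  obtain a where a: "\<psi> a \<noteq> 0"
    using assms by (force simp: bump_def)
  define \<eta> :: "real^3 \<Rightarrow> real" where
    "\<eta> x = 1 / \<psi> a ^ 3 * (\<psi> (x $ 1 + a) * (\<psi> (x $ 2 + a) * \<psi> (x $ 3 + a)))" for x
  have coord: "smooth (\<lambda>x::real^3. \<psi> (x $ i + a))" for i
    using smooth_compose_affine[OF sm bounded_linear_vec_nth[of i]] .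
  have "smooth \<eta>"
    using smooth_mult[OF smooth_const[of "1 / \<psi> a ^ 3"]
        smooth_mult[OF coord[of 1] smooth_mult[OF coord[of 2] coord[of 3]]]]
    unfolding \<eta>_def .
  moreover have "norm x \<le> 3 * (2 + \<bar>a\<bar>)" if "\<eta> x \<noteq> 0" for x
  proof -
    have nz: "\<psi> (x $ i + a) \<noteq> 0" for i
      using that exhaust_3[of i] by (auto simp: \<eta>_def)
    have "\<bar>x $ i\<bar> \<le> 2 + \<bar>a\<bar>" for i
    proof -
      have "1/2 \<le> x $ i + a" "x $ i + a \<le> 2"
        using supp[of "x $ i + a"] nz[of i] by auto
      then show ?thesis
        by linarith
    qed
    then have "(\<Sum>i\<in>UNIV. \<bar>x $ i\<bar>) \<le> (\<Sum>i\<in>(UNIV::3 set). 2 + \<bar>a\<bar>)"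
      by (intro sum_mono)
    then show ?thesis
      using norm_le_l1_cart[of x] by simp
  qed
  then have "bounded {x. \<eta> x \<noteq> 0}"
    by (auto simp: bounded_iff)
  moreover have "\<eta> 0 = 1"
    using a by (simp add: \<eta>_def power3_eq_cube)
  ultimately show ?thesis ..
qed

subsection \<open>Fields with vanishing gradient\<close>

text \<open>If the Fourier integrand is not integrable, its Bochner integral is 0 by default.
  Otherwise \<open>w\<close> is integrable on \<open>S\<close>, since the exponential has modulus 1,
  and the real and imaginary parts are the cosine and sine integrals up to sign. This is why both
  assumptions may require integrability.\<close>

lemma fourier_component_eq_0:
  fixes w :: "real^3 \<Rightarrow> real"
  assumes cos0: "set_integrable lborel S w \<Longrightarrow> (LINT x:S|lborel. w x * cos (x \<bullet> \<xi>)) = 0"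
    and sin0: "set_integrable lborel S w \<Longrightarrow> (LINT x:S|lborel. w x * sin (x \<bullet> \<xi>)) = 0"
  shows "(LINT x:S|lborel. exp (- (\<i> * complex_of_real (x \<bullet> \<xi>))) * complex_of_real (w x)) = 0"
proof -
  define h where "h x = indicator S x *\<^sub>R
    (exp (- (\<i> * complex_of_real (x \<bullet> \<xi>))) * complex_of_real (w x))" for x
  have Re: "Re (h x) = indicator S x *\<^sub>R (w x * cos (x \<bullet> \<xi>))"
    and Im: "Im (h x) = - (indicator S x *\<^sub>R (w x * sin (x \<bullet> \<xi>)))" for x
    by (auto simp: h_def Re_exp Im_exp)
  have "integral\<^sup>L lborel h = 0" if h: "integrable lborel h"
  proof -
    \<comment> \<open>Multiplying by the inverse exponential recovers \<open>w\<close> on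
      \<open>S\<close> from \<open>h\<close>; measurability of \<open>w\<close>, which is not
      assumed, follows from that of \<open>h\<close>.\<close>
    have eq: "indicator S x *\<^sub>R w x = Re (h x * exp (\<i> * complex_of_real (x \<bullet> \<xi>)))" for x
    proof -
      let ?z = "\<i> * complex_of_real (x \<bullet> \<xi>)"
      have "h x * exp ?z = indicator S x *\<^sub>R ((exp (- ?z) * exp ?z) * complex_of_real (w x))"
        unfolding h_def by simp
      then show ?thesis
        by (simp only: exp_add[symmetric]) simp
    qed
    have "set_integrable lborel S w"
      unfolding set_integrable_def
    proof (rule Bochner_Integration.integrable_bound[OF h])
      show "(\<lambda>x. indicator S x *\<^sub>R w x) \<in> borel_measurable lborel"
        unfolding eq using borel_measurable_integrable[OF h] by measurable
      show "AE x in lborel. norm (indicator S x *\<^sub>R w x) \<le> norm (h x)"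
        by (auto simp: h_def norm_mult abs_mult)
    qed
    from cos0[OF this] sin0[OF this]
    have "Re (integral\<^sup>L lborel h) = 0" "Im (integral\<^sup>L lborel h) = 0"
      by (simp_all add: integral_Re[OF h, symmetric] integral_Im[OF h, symmetric] Re Im
          set_lebesgue_integral_def)
    then show ?thesis
      by (simp add: complex_eq_iff)
  qed
  then show ?thesis
    unfolding set_lebesgue_integral_def h_def[symmetric]
    using not_integrable_integral_eq by blast
qed

text \<open>A translation by one period changes the phase by a multiple of \<open>2 * pi\<close>,
  which makes the plane waves of the dual lattice periodic test functions.\<close>

lemma inner_axis_dual_lattice:
  assumes "k \<in> dual_lattice L" "L > 0"
  obtains n :: int where "(x + L *\<^sub>R axis i 1) \<bullet> k = x \<bullet> k + 2 * pi * of_int n"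
proof -
  obtain n :: int where "k $ i = 2 * pi / L * of_int n"
    using assms(1) unfolding dual_lattice_def by blast
  then have "L * k $ i = 2 * pi * of_int n"
    using assms(2) by simp
  then show ?thesis
    by (intro that[of n]) (simp add: inner_add_left inner_axis')
qed

lemma test_function_sin_T3:
  assumes "k \<in> dual_lattice L" "L > 0"
  shows "test_function (T3 L) (\<lambda>x. sin (x \<bullet> k))"
proof -
  have "sin ((x + L *\<^sub>R axis i 1) \<bullet> k) = sin (x \<bullet> k)" for x :: "real^3" and i
    by (rule inner_axis_dual_lattice[OF assms, of x i]) (simp add: sin_add)
  then show ?thesis
    by (simp add: smooth_sin_inner)
qed

lemma test_function_cos_T3:
  assumes "k \<in> dual_lattice L" "L > 0"
  shows "test_function (T3 L) (\<lambda>x. cos (x \<bullet> k))"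
proof -
  have "cos ((x + L *\<^sub>R axis i 1) \<bullet> k) = cos (x \<bullet> k)" for x :: "real^3" and i
    by (rule inner_axis_dual_lattice[OF assms, of x i]) (simp add: cos_add)
  then show ?thesis
    by (simp add: smooth_cos_inner)
qed

text \<open>Bounded smooth functions are limits of test functions \<open>\<eta> (x / n) c x\<close>, and the
  derivatives of the cutoff factors vanish in the limit.\<close>

lemma integral_partial_eq_0_R3:
  fixes w :: "real^3 \<Rightarrow> real"
  assumes "bump \<psi>" and w: "integrable lborel w"
    and zero: "\<And>\<phi>. test_function R3 \<phi> \<Longrightarrow> (LINT x|lborel. w x * partial j \<phi> x) = 0"
    and c: "smooth c" "\<And>x. \<bar>c x\<bar> \<le> M" "\<And>x. \<bar>partial j c x\<bar> \<le> N"
  shows "(LINT x|lborel. w x * partial j c x) = 0"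
proof -
  obtain \<eta> :: "real^3 \<Rightarrow> real" where \<eta>: "smooth \<eta>" "bounded {x. \<eta> x \<noteq> 0}" "\<eta> 0 = 1"
    using smooth_cutoff_exists[OF assms(1)] .
  obtain A where A: "\<And>x. \<bar>\<eta> x\<bar> \<le> A"
    using bounded_range_of_bounded_support[OF continuous_on_smooth[OF \<eta>(1)] \<eta>(2)] by blast
  have "bounded {x. partial j \<eta> x \<noteq> 0}"
    using partial_eq_0_outside_support[of _ \<eta> j]
    by (intro bounded_subset[OF bounded_closure[OF \<eta>(2)]]) blast
  then obtain B where B: "\<And>x. \<bar>partial j \<eta> x\<bar> \<le> B"
    using bounded_range_of_bounded_support[OF continuous_on_partial[OF \<eta>(1)]] by blast
  \<comment> \<open>The index is shifted to keep the scale positive; \<open>r n \<le> 1\<close>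
    later absorbs the factor that the chain rule produces.\<close>
  define r where "r n = 1 / real (Suc n)" for n
  have r: "0 < r n" "r n \<le> 1" for n
    by (auto simp: r_def)
  have r0: "r \<longlonglongrightarrow> 0"
    unfolding r_def using LIMSEQ_inverse_real_of_nat by (simp add: inverse_eq_divide)
  define \<phi> where "\<phi> n x = \<eta> (r n *\<^sub>R x) * c x" for n x
  have sm: "smooth (\<lambda>x. \<eta> (r n *\<^sub>R x))" for n
    using smooth_compose_affine[OF \<eta>(1) bounded_linear_scaleR_right, of _ 0] by simp
  have "bounded {x. \<phi> n x \<noteq> 0}" for n
  proof -
    have "{x. \<phi> n x \<noteq> 0} \<subseteq> (\<lambda>x. (1 / r n) *\<^sub>R x) ` {x. \<eta> x \<noteq> 0}"
      using r(1)[of n] by (auto simp: \<phi>_def intro!: image_eqI[where x = "r n *\<^sub>R _"])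
    then show ?thesis
      using bounded_subset bounded_scaling[OF \<eta>(2)] by blast
  qed
  moreover have sm\<phi>: "smooth (\<phi> n)" for n
    using smooth_mult[OF sm c(1)] unfolding \<phi>_def .
  ultimately have "test_function R3 (\<phi> n)" for n
    by (simp add: compact_closure)
  note int0 = zero[OF this]
  have D: "partial j (\<phi> n) x
      = \<eta> (r n *\<^sub>R x) * partial j c x + r n * partial j \<eta> (r n *\<^sub>R x) * c x" for n x
    unfolding \<phi>_def partial_mult[OF sm c(1)] partial_scaleR[OF \<eta>(1)] ..
  have meas: "partial j f \<in> borel_measurable lborel" if "smooth f" for f :: "real^3 \<Rightarrow> real"
    using borel_measurable_continuous_onI[OF continuous_on_partial[OF that]] by simp
  have "(\<lambda>n. LINT x|lborel. w x * partial j (\<phi> n) x) \<longlonglongrightarrow> (LINT x|lborel. w x * partial j c x)"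
  \<comment> \<open>By the product rule, \<open>A * N\<close> bounds the term in which the wave is
    differentiated and \<open>B * M\<close> the one in which the cutoff is.\<close>
  proof (rule integral_dominated_convergence[where w = "\<lambda>x. (A * N + B * M) * \<bar>w x\<bar>"])
    show "(\<lambda>x. w x * partial j c x) \<in> borel_measurable lborel"
      using borel_measurable_integrable[OF w] meas[OF c(1)] by measurable
    show "(\<lambda>x. w x * partial j (\<phi> n) x) \<in> borel_measurable lborel" for n
      using borel_measurable_integrable[OF w] meas[OF sm\<phi>] by measurable
    show "integrable lborel (\<lambda>x. (A * N + B * M) * \<bar>w x\<bar>)"
      using w by auto
    have lim: "(\<lambda>n. g (r n *\<^sub>R x)) \<longlonglongrightarrow> g 0" if "continuous_on UNIV g" for g :: "real^3 \<Rightarrow> real" and x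
    proof -
      have "(\<lambda>n. r n *\<^sub>R x) \<longlonglongrightarrow> 0"
        using tendsto_scaleR[OF r0 tendsto_const[of x]] by simp
      from continuous_on_tendsto_compose[OF that this] show ?thesis
        by simp
    qed
    have "(\<lambda>n. partial j (\<phi> n) x) \<longlonglongrightarrow> \<eta> 0 * partial j c x + 0 * partial j \<eta> 0 * c x" for x
      unfolding D
      by (intro tendsto_intros lim r0 continuous_on_smooth continuous_on_partial \<eta>(1))
    then show "AE x in lborel. (\<lambda>n. w x * partial j (\<phi> n) x) \<longlonglongrightarrow> w x * partial j c x"
      by (auto simp: \<eta>(3) intro!: tendsto_mult_left)
    have "\<bar>partial j (\<phi> n) x\<bar> \<le> A * N + B * M" for n x
    proof -
      have "\<bar>r n * partial j \<eta> (r n *\<^sub>R x)\<bar> \<le> 1 * B"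
        unfolding abs_mult using r[of n] B by (intro mult_mono) auto
      then have "\<bar>r n * partial j \<eta> (r n *\<^sub>R x) * c x\<bar> \<le> B * M"
        unfolding abs_mult[of _ "c x"] using c(2)[of x] by (intro mult_mono) auto
      moreover have "\<bar>\<eta> (r n *\<^sub>R x) * partial j c x\<bar> \<le> A * N"
        unfolding abs_mult using A[of "r n *\<^sub>R x"] c(3)[of x] by (intro mult_mono) auto
      ultimately show ?thesis
        unfolding D by linarith
    qed
    then show "AE x in lborel. norm (w x * partial j (\<phi> n) x) \<le> (A * N + B * M) * \<bar>w x\<bar>" for n
      by (intro AE_I2) (simp add: abs_mult mult_right_mono mult.commute[of "\<bar>w _\<bar>"])
  qed
  then show ?thesis
    by (simp add: int0 LIMSEQ_const_iff)
qed

text \<open>Some coordinate \<open>\<xi> $ j\<close> is nonzero. Differentiating the sine and cosine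
  waves in direction \<open>j\<close> gives the cosine and sine waves times this coordinate up to
  sign, so dividing by it kills both integrals. On the torus the waves are test functions
  themselves; on the whole space they are reached as limits.\<close>

lemma fourier_eq_0_if_gradient_0:
  assumes \<Omega>: "\<Omega> = R3 \<or> (\<exists>L>0. \<Omega> = T3 L \<and> \<xi> \<in> dual_lattice L)"
    and "bump \<psi>" and "\<xi> \<noteq> 0"
    and zero: "\<And>\<phi> i j. test_function \<Omega> \<phi> \<Longrightarrow> (LINT x:cell \<Omega>|lborel. f x $ i * partial j \<phi> x) = 0"
  shows "fourier \<Omega> f \<xi> = 0"
proof -
  obtain j where j: "\<xi> $ j \<noteq> 0"
    using assms(3) by (auto simp: vec_eq_iff)
  have trig: "(LINT x:cell \<Omega>|lborel. f x $ i * partial j (\<lambda>x. sin (x \<bullet> \<xi>)) x) = 0 \<and>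
      (LINT x:cell \<Omega>|lborel. f x $ i * partial j (\<lambda>x. cos (x \<bullet> \<xi>)) x) = 0"
    if int: "set_integrable lborel (cell \<Omega>) (\<lambda>x. f x $ i)" for i
  proof (cases \<Omega>)
    case R3
    have "integrable lborel (\<lambda>x. f x $ i)"
      using int R3 by (simp add: set_integrable_def)
    note R = integral_partial_eq_0_R3[OF assms(2) this, of j]
    have z: "(LINT x|lborel. f x $ i * partial j \<phi> x) = 0" if "test_function R3 \<phi>" for \<phi>
      using zero[of \<phi> i j] that R3 by (simp add: set_lebesgue_integral_def del: test_function.simps)
    have "(LINT x|lborel. f x $ i * partial j (\<lambda>x. sin (x \<bullet> \<xi>)) x) = 0"
      by (rule R[OF z smooth_sin_inner, where M = 1 and N = "\<bar>\<xi> $ j\<bar>"])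
        (simp_all add: partial_sin_inner abs_mult mult_left_le)
    moreover have "(LINT x|lborel. f x $ i * partial j (\<lambda>x. cos (x \<bullet> \<xi>)) x) = 0"
      by (rule R[OF z smooth_cos_inner, where M = 1 and N = "\<bar>\<xi> $ j\<bar>"])
        (simp_all add: partial_cos_inner abs_mult mult_left_le)
    ultimately show ?thesis
      by (simp add: R3 set_lebesgue_integral_def)
  next
    case (T3 L)
    then show ?thesis
      using \<Omega> zero[of _ i j] test_function_sin_T3[of \<xi> L] test_function_cos_T3[of \<xi> L] by auto
  qed
  have comp: "(LINT x:cell \<Omega>|lborel. exp (- (\<i> * complex_of_real (x \<bullet> \<xi>))) * complex_of_real (f x $ i)) = 0" for i
  proof (rule fourier_component_eq_0)
    assume int: "set_integrable lborel (cell \<Omega>) (\<lambda>x. f x $ i)"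
    have "\<xi> $ j * (LINT x:cell \<Omega>|lborel. f x $ i * cos (x \<bullet> \<xi>)) = 0"
      using trig[OF int] unfolding set_integral_mult_right[symmetric]
      by (simp add: partial_sin_inner ac_simps)
    then show "(LINT x:cell \<Omega>|lborel. f x $ i * cos (x \<bullet> \<xi>)) = 0"
      using j by simp
    have "- (\<xi> $ j) * (LINT x:cell \<Omega>|lborel. f x $ i * sin (x \<bullet> \<xi>)) = 0"
      using trig[OF int] unfolding set_integral_mult_right[symmetric]
      by (simp add: partial_cos_inner ac_simps)
    then show "(LINT x:cell \<Omega>|lborel. f x $ i * sin (x \<bullet> \<xi>)) = 0"
      using j by simp
  qed
  then show ?thesis
    by (simp add: fourier_def vec_eq_iff)
qed

lemma E_star_eq_0_if_fourier_0:
  assumes "bump \<psi>"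
    and zero: "\<And>\<xi>. \<xi> \<noteq> 0 \<Longrightarrow> (\<And>L. \<Omega> = T3 L \<Longrightarrow> \<xi> \<in> dual_lattice L) \<Longrightarrow> fourier \<Omega> (u t) \<xi> = 0"
    and "K \<in> freqs \<Omega>"
  shows "E_star \<Omega> \<psi> u K t = 0"
proof (cases \<Omega>)
  case R3
  \<comment> \<open>Nothing is known about the Fourier transform at frequency 0, but the bump does
    not see it.\<close>
  have "\<psi> 0 = 0"
    using assms(1) by (auto simp: bump_def)
  then have "\<psi> (norm \<xi> / K) * (norm (fourier R3 (u t) \<xi>))\<^sup>2 / (2 * pi) ^ 3 = 0" for \<xi>
    using zero[of \<xi>] R3 by (cases "\<xi> = 0") auto
  then show ?thesis
    by (simp only: R3 E_star.simps) simp
next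
  case (T3 L)
  have "K \<noteq> 0"
    using assms(3) T3 by auto
  then have "(\<Sum>k\<in>{k \<in> dual_lattice L. norm k = K}. (norm (fourier (T3 L) (u t) k))\<^sup>2) = 0"
    using zero T3 by (intro sum.neutral) auto
  then show ?thesis
    by (simp add: T3)
qed

section \<open>Measurability in space and time, and positivity of the mean dissipation\<close>

text \<open>Setting the field to 0 at negative times gives a jointly measurable function on all of
  space-time, as integrals with a parameter require.\<close>

lemma spacetime_measurable_extend:
  assumes "spacetime_measurable (w :: real \<Rightarrow> real^3 \<Rightarrow> 'b::{real_normed_vector, second_countable_topology})"
  obtains v where "(\<lambda>(t, x). v t x) \<in> borel_measurable (lborel \<Otimes>\<^sub>M lborel)" "\<And>t. 0 \<le> t \<Longrightarrow> v t = w t"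
proof
  let ?v = "\<lambda>t x. indicator ({0..} \<times> UNIV) (t, x) *\<^sub>R w t x"
  have "(\<lambda>(t, x). ?v t x) \<in> borel_measurable borel"
    using assms unfolding spacetime_measurable_def set_borel_measurable_def
    by (simp add: case_prod_beta')
  then show "(\<lambda>(t, x). ?v t x) \<in> borel_measurable (lborel \<Otimes>\<^sub>M lborel)"
    by (simp add: borel_prod[symmetric] cong: measurable_cong_sets)
  show "?v t = w t" if "0 \<le> t" for t
    using that by (simp add: fun_eq_iff)
qed

lemma cell_measurable [measurable]: "cell \<Omega> \<in> sets borel"
  by (cases \<Omega>) auto

lemma L2_norm_sq_eq_0_AE:
  fixes f :: "real^3 \<Rightarrow> 'b::{real_normed_vector, second_countable_topology}"
  assumes [measurable]: "f \<in> borel_measurable borel" and "L2_norm_sq \<Omega> f = 0"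
  shows "AE x in lborel. x \<in> cell \<Omega> \<longrightarrow> f x = 0"
proof -
  have "AE x in lborel. ennreal ((norm (f x))\<^sup>2) * indicator (cell \<Omega>) x = 0"
    using assms(2) unfolding L2_norm_sq_def by (subst (asm) nn_integral_0_iff_AE) auto
  then show ?thesis
    by eventually_elim (auto simp: indicator_def)
qed

lemma L1_norm_measurable:
  assumes "(\<lambda>(t, x). v t x) \<in> borel_measurable (lborel \<Otimes>\<^sub>M lborel)"
  shows "(\<lambda>t. L1_norm \<Omega> (v t)) \<in> borel_measurable borel"
  unfolding L1_norm_def using assms by measurable

lemma L2_norm_sq_measurable:
  assumes "(\<lambda>(t, x). v t x) \<in> borel_measurable (lborel \<Otimes>\<^sub>M lborel)"
  shows "(\<lambda>t. L2_norm_sq \<Omega> (v t)) \<in> borel_measurable borel"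
  unfolding L2_norm_sq_def using assms by measurable

lemma weak_gradient_grad: "u \<in> leray_space \<Omega> \<Longrightarrow> weak_gradient \<Omega> u (grad \<Omega> u)"
  unfolding grad_def leray_space_def using someI_ex[of "weak_gradient \<Omega> u"] by blast

text \<open>In \<open>weak_gradient\<close> the exceptional null set of times does not depend on the
  test function, so at a fixed good time every test function is available at once.\<close>

lemma E_star_eq_0_if_grad_0:
  assumes \<Omega>: "\<Omega> = R3 \<or> (\<exists>L>0. \<Omega> = T3 L)" and "bump \<psi>" and u: "u \<in> leray_space \<Omega>" and K: "K \<in> freqs \<Omega>"
  shows "AE t in lborel. 0 \<le> t \<longrightarrow> L2_norm_sq \<Omega> (grad \<Omega> u t) = 0 \<longrightarrow> E_star \<Omega> \<psi> u K t = 0"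
proof -
  let ?G = "grad \<Omega> u"
  note G = weak_gradient_grad[OF u, unfolded weak_gradient_def]
  obtain v where v: "(\<lambda>(t, x). v t x) \<in> borel_measurable (lborel \<Otimes>\<^sub>M lborel)" "\<And>t. 0 \<le> t \<Longrightarrow> v t = ?G t"
    using spacetime_measurable_extend G by blast
  have "AE t in lborel. 0 \<le> t \<longrightarrow>
      (\<forall>\<phi> i j. test_function \<Omega> \<phi> \<longrightarrow>
         (LINT x:cell \<Omega>|lborel. u t x $ i * partial j \<phi> x)
           = - (LINT x:cell \<Omega>|lborel. ?G t x $ i $ j * \<phi> x))"
    using G by (auto elim!: eventually_mono)
  then show ?thesis
  proof eventually_elim
    case (elim t)
    show ?case
    proof (intro impI)
      assume t: "0 \<le> t" and 0: "L2_norm_sq \<Omega> (?G t) = 0"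
      have "v t \<in> borel_measurable borel"
        using v(1) by measurable
      then have AE0: "AE x in lborel. x \<in> cell \<Omega> \<longrightarrow> ?G t x = 0"
        using L2_norm_sq_eq_0_AE[of "?G t"] v(2)[OF t] 0 by simp
      have "(LINT x:cell \<Omega>|lborel. ?G t x $ i $ j * \<phi> x) = 0" for i j \<phi>
        unfolding set_lebesgue_integral_def
        by (rule integral_eq_zero_AE) (use AE0 in \<open>auto elim!: eventually_mono simp: indicator_def\<close>)
      then have zero: "(LINT x:cell \<Omega>|lborel. u t x $ i * partial j \<phi> x) = 0" if "test_function \<Omega> \<phi>" for i j \<phi>
        using elim t that by auto
      have "fourier \<Omega> (u t) \<xi> = 0" if "\<xi> \<noteq> 0" "\<And>L. \<Omega> = T3 L \<Longrightarrow> \<xi> \<in> dual_lattice L" for \<xi>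
        by (rule fourier_eq_0_if_gradient_0[OF _ \<open>bump \<psi>\<close> that(1) zero]) (use \<Omega> that(2) in auto)
      then show "E_star \<Omega> \<psi> u K t = 0"
        using E_star_eq_0_if_fourier_0[where \<Omega> = \<Omega> and u = u and t = t, OF \<open>bump \<psi>\<close> _ K] by blast
    qed
  qed
qed

text \<open>If the mean dissipation vanished, then \<open>u t\<close> would be spatially constant for almost all
  times in \<open>[T0, T1]\<close>, and its spectrum would vanish at all nonzero frequencies.\<close>

lemma time_avg_dissipation_pos:
  assumes \<Omega>: "\<Omega> = R3 \<or> (\<exists>L>0. \<Omega> = T3 L)" and "\<nu> > 0" and "bump \<psi>"
    and T: "0 \<le> T0" "T0 < T1" and u: "u \<in> leray_space \<Omega>" and K: "K \<in> freqs \<Omega>"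
    and E: "E_star_avg \<Omega> \<psi> u T0 T1 K > 0"
  shows "time_avg T0 T1 (dissipation \<Omega> \<nu> u) > 0"
proof -
  let ?G = "grad \<Omega> u"
  note G = weak_gradient_grad[OF u, unfolded weak_gradient_def]
  obtain v where v: "(\<lambda>(t, x). v t x) \<in> borel_measurable (lborel \<Otimes>\<^sub>M lborel)" "\<And>t. 0 \<le> t \<Longrightarrow> v t = ?G t"
    using spacetime_measurable_extend G by blast
  define n where "n t = L2_norm_sq \<Omega> (v t)" for t
  have [measurable]: "n \<in> borel_measurable borel"
    using L2_norm_sq_measurable[OF v(1)] unfolding n_def .
  have n: "L2_norm_sq \<Omega> (?G t) = n t" if "0 \<le> t" for t
    using v(2)[OF that] by (simp add: n_def)
  have "(\<integral>\<^sup>+t\<in>{0..}. n t \<partial>lborel) = (\<integral>\<^sup>+t\<in>{0..}. L2_norm_sq \<Omega> (?G t) \<partial>lborel)"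
    by (intro nn_integral_cong) (auto simp: n indicator_def)
  then have fin: "(\<integral>\<^sup>+t\<in>{0..}. n t \<partial>lborel) < \<infinity>"
    using u by (simp add: leray_space_def)
  \<comment> \<open>\<open>enn2real\<close> sends \<open>\<infinity>\<close> to 0, so
    \<open>d t = 0\<close> forces \<open>n t = 0\<close> only where \<open>n t\<close> is
    finite.\<close>
  have AEfin: "AE t in lborel. 0 \<le> t \<longrightarrow> n t < \<infinity>"
    using nn_integral_PInf_AE[of "\<lambda>t. n t * indicator {0..} t" lborel] fin
    by (auto simp: indicator_def less_top elim!: eventually_mono)
  define c where "c = 2 * rho \<Omega> * \<nu>"
  have c: "c > 0"
    using \<Omega> \<open>\<nu> > 0\<close> by (auto simp: c_def)
  define d where "d t = indicator {T0..T1} t *\<^sub>R (c * enn2real (n t))" for t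
  have d: "indicator {T0..T1} t *\<^sub>R dissipation \<Omega> \<nu> u t = d t" for t
    using T n[of t] by (auto simp: d_def dissipation_def c_def indicator_def)
  \<comment> \<open>A nonintegrable function would also have integral 0. The bound comes from the
    finite space-time norm of the gradient in the Leray space.\<close>
  have int: "integrable lborel d"
  proof (rule integrableI_bounded)
    show "d \<in> borel_measurable lborel"
      unfolding d_def by measurable
    have "(\<integral>\<^sup>+t. ennreal (norm (d t)) \<partial>lborel) \<le> (\<integral>\<^sup>+t. ennreal c * (n t * indicator {0..} t) \<partial>lborel)"
    proof (rule nn_integral_mono)
      fix t
      have "ennreal (enn2real (n t)) \<le> n t"
        by (cases "n t") auto
      then show "ennreal (norm (d t)) \<le> ennreal c * (n t * indicator {0..} t)"
        using T c by (auto simp: d_def indicator_def ennreal_mult intro: mult_left_mono)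
    qed
    also have "\<dots> < \<infinity>"
      using fin by (subst nn_integral_cmult) (auto simp: ennreal_mult_less_top)
    finally show "(\<integral>\<^sup>+t. ennreal (norm (d t)) \<partial>lborel) < \<infinity>" .
  qed
  have nonneg: "0 \<le> d t" for t
    using c by (simp add: d_def)
  have "integral\<^sup>L lborel d \<noteq> 0"
  proof
    assume "integral\<^sup>L lborel d = 0"
    then have "AE t in lborel. d t = 0"
      using integral_nonneg_eq_0_iff_AE[OF int] nonneg by simp
    with AEfin have "AE t in lborel. t \<in> {T0..T1} \<longrightarrow> n t = 0"
      by eventually_elim (use T c in \<open>auto simp: d_def enn2real_eq_0_iff\<close>)
    with E_star_eq_0_if_grad_0[OF \<Omega> \<open>bump \<psi>\<close> u K]
    have "AE t in lborel. indicator {T0..T1} t *\<^sub>R E_star \<Omega> \<psi> u K t = 0"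
      by eventually_elim (use T n in \<open>auto simp: indicator_def\<close>)
    then have "E_star_avg \<Omega> \<psi> u T0 T1 K = 0"
      by (simp add: E_star_avg_def time_avg_def set_lebesgue_integral_def integral_eq_zero_AE)
    then show False
      using E by simp
  qed
  moreover have "0 \<le> integral\<^sup>L lborel d"
    using nonneg by simp
  ultimately show ?thesis
    using T unfolding time_avg_def set_lebesgue_integral_def d by simp
qed

subsection \<open>Differentiability of the averaged spectrum\<close>

text \<open>Dominated convergence for difference quotients along sequences. A Lipschitz bound
  centred at \<open>s0\<close> suffices, and the pointwise derivative is measurable as a limit of
  such quotients.\<close>

lemma field_differentiable_integral:
  fixes F :: "real \<Rightarrow> 'a \<Rightarrow> real"
  assumes "open S" "s0 \<in> S"
    and int: "\<And>s. s \<in> S \<Longrightarrow> integrable M (F s)"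
    and diff: "\<And>x. x \<in> space M \<Longrightarrow> (\<lambda>s. F s x) field_differentiable at s0"
    and lip: "\<And>x s. x \<in> space M \<Longrightarrow> s \<in> S \<Longrightarrow> \<bar>F s x - F s0 x\<bar> \<le> g x * \<bar>s - s0\<bar>"
    and g: "integrable M g"
  shows "(\<lambda>s. integral\<^sup>L M (F s)) field_differentiable at s0"
proof -
  define D where "D x = deriv (\<lambda>s. F s x) s0" for x
  have D: "((\<lambda>s. (F s x - F s0 x) / (s - s0)) \<longlongrightarrow> D x) (at s0)" if "x \<in> space M" for x
    using diff[OF that, folded DERIV_deriv_iff_field_differentiable]
    unfolding D_def has_field_derivative_iff .
  have "((\<lambda>s. (integral\<^sup>L M (F s) - integral\<^sup>L M (F s0)) / (s - s0)) \<longlongrightarrow> integral\<^sup>L M D) (at s0)"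
    unfolding tendsto_at_iff_sequentially comp_def
  proof (intro allI impI)
    fix X :: "nat \<Rightarrow> real"
    assume X: "\<forall>i. X i \<in> UNIV - {s0}" "X \<longlonglongrightarrow> s0"
    have "eventually (\<lambda>n. X n \<in> S) sequentially"
      using X(2) assms(1,2) by (rule topological_tendstoD)
    then obtain N where N: "\<And>n. N \<le> n \<Longrightarrow> X n \<in> S"
      by (auto simp: eventually_sequentially)
    \<comment> \<open>Dropping the first \<open>N\<close> terms leaves only points of
      \<open>S\<close>, where integrability and the Lipschitz bound hold, and does not affect the
      limit.\<close>
    define Y where "Y n = X (n + N)" for n
    have Y: "Y n \<in> S" "Y n \<noteq> s0" for n
      using N X(1) by (auto simp: Y_def)
    have "Y \<longlonglongrightarrow> s0"
      unfolding Y_def by (rule LIMSEQ_ignore_initial_segment[OF X(2)])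
    then have lim: "(\<lambda>n. (F (Y n) x - F s0 x) / (Y n - s0)) \<longlonglongrightarrow> D x" if "x \<in> space M" for x
      using D[OF that, unfolded tendsto_at_iff_sequentially comp_def, rule_format, of Y] Y(2) by simp
    have meas: "(\<lambda>x. (F (Y n) x - F s0 x) / (Y n - s0)) \<in> borel_measurable M" for n
      by (intro borel_measurable_divide borel_measurable_diff borel_measurable_const
          borel_measurable_integrable int Y(1) assms(2))
    have "(\<lambda>n. LINT x|M. (F (Y n) x - F s0 x) / (Y n - s0)) \<longlonglongrightarrow> integral\<^sup>L M D"
    proof (rule integral_dominated_convergence[OF _ meas g])
      show "D \<in> borel_measurable M"
        by (rule borel_measurable_LIMSEQ_real[OF lim meas])
      show "AE x in M. norm ((F (Y n) x - F s0 x) / (Y n - s0)) \<le> g x" for n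
        using lip[OF _ Y(1)] Y(2) by (intro AE_I2) (simp add: abs_divide divide_le_eq)
      show "AE x in M. (\<lambda>n. (F (Y n) x - F s0 x) / (Y n - s0)) \<longlonglongrightarrow> D x"
        by (intro AE_I2 lim)
    qed
    moreover have "(LINT x|M. (F (Y n) x - F s0 x) / (Y n - s0))
        = (integral\<^sup>L M (F (Y n)) - integral\<^sup>L M (F s0)) / (Y n - s0)" for n
      by (simp add: Bochner_Integration.integral_diff[OF int[OF Y(1)] int[OF assms(2)]])
    ultimately have "(\<lambda>n. (integral\<^sup>L M (F (Y n)) - integral\<^sup>L M (F s0)) / (Y n - s0)) \<longlonglongrightarrow> integral\<^sup>L M D"
      by (simp only:)
    then show "(\<lambda>n. (integral\<^sup>L M (F (X n)) - integral\<^sup>L M (F s0)) / (X n - s0)) \<longlonglongrightarrow> integral\<^sup>L M D"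
      unfolding Y_def by (rule LIMSEQ_offset)
  qed
  then show ?thesis
    unfolding field_differentiable_def has_field_derivative_iff by blast
qed

lemma smooth_real_has_derivative:
  fixes f :: "real \<Rightarrow> real"
  assumes "smooth f"
  shows "(f has_real_derivative frechet_derivative f (at x) 1) (at x)"
proof -
  note D = smooth_has_derivative[OF assms, of x]
  have "frechet_derivative f (at x) = (*) (frechet_derivative f (at x) 1)"
  proof
    show "frechet_derivative f (at x) h = frechet_derivative f (at x) 1 * h" for h
      using linear_cmul[OF has_derivative_linear[OF D], of h 1] by simp
  qed
  from has_derivative_eq_rhs[OF D this] show ?thesis
    unfolding has_field_derivative_def .
qed

text \<open>The derivative is continuous, hence bounded on the compact interval
  \<open>{1/2..2}\<close>, and it vanishes off it; the mean value inequality does the rest.\<close>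

lemma bump_lipschitz:
  assumes "bump \<psi>"
  obtains D where "0 \<le> D" "\<And>x y. \<bar>\<psi> x - \<psi> y\<bar> \<le> D * \<bar>x - y\<bar>"
proof -
  have sm: "smooth \<psi>" and supp: "\<And>r. r \<notin> {1/2..2} \<Longrightarrow> \<psi> r = 0"
    using assms by (auto simp: bump_def)
  define \<psi>' where "\<psi>' x = frechet_derivative \<psi> (at x) 1" for x
  have deriv: "(\<psi> has_real_derivative \<psi>' x) (at x)" for x
    using smooth_real_has_derivative[OF sm] by (simp add: \<psi>'_def)
  have "continuous_on UNIV \<psi>'"
    using Ck_SucD(2)[of 0 \<psi> 1] sm by (simp add: smooth_def \<psi>'_def del: Ck.simps(2))
  then have "bounded (\<psi>' ` {1/2..2})"
    by (rule compact_imp_bounded[OF compact_continuous_image[OF continuous_on_subset[OF _ subset_UNIV] compact_Icc]])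
  then obtain D where "\<forall>y\<in>\<psi>' ` {1/2..2}. \<bar>y\<bar> \<le> D"
    unfolding bounded_real by (rule exE)
  then have D: "\<bar>\<psi>' x\<bar> \<le> D" if "x \<in> {1/2..2}" for x
    using that by (intro bspec[of "\<psi>' ` {1/2..2}" "\<lambda>y. \<bar>y\<bar> \<le> D"] imageI)
  have out: "\<psi>' x = 0" if "x \<notin> {1/2..2}" for x
  proof -
    have "((\<lambda>_. 0) has_real_derivative 0) (at x)"
      by simp
    then have "(\<psi> has_real_derivative 0) (at x)"
      by (rule has_field_derivative_transform_within_open[where S = "- {1/2..2}"])
        (use that in \<open>simp_all add: supp open_Compl\<close>)
    from DERIV_unique[OF deriv this] show ?thesis .
  qed
  have "0 \<le> D"
    using D[of 1] abs_ge_zero order_trans by fastforce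
  then have "\<bar>\<psi>' x\<bar> \<le> D" for x
    using D[of x] out[of x] by (cases "x \<in> {1/2..2}") simp_all
  then have "norm (\<psi> x - \<psi> y) \<le> D * norm (x - y)" for x y
    by (intro field_differentiable_bound[OF convex_UNIV, where f' = \<psi>'])
      (simp_all add: deriv)
  then show ?thesis
    using \<open>0 \<le> D\<close> by (intro that[of D]) simp_all
qed

text \<open>For \<open>s\<close> above \<open>s0 / 2\<close> the integrand lives in the fixed ball
  of radius \<open>4 / s0\<close>. There \<open>D * 2\<close> bounds \<open>\<psi>\<close> and
  \<open>D * (4 / s0)\<close> is a Lipschitz constant in \<open>s\<close>; \<open>c\<close> covers
  both, multiplied by the volume of the ball. It does not depend on \<open>q\<close> or
  \<open>B\<close>, which may therefore vary with time.\<close>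

lemma radial_integral_regular:
  fixes q :: "real^3 \<Rightarrow> real"
  assumes "bump \<psi>" and D: "0 \<le> D" "\<And>x y. \<bar>\<psi> x - \<psi> y\<bar> \<le> D * \<bar>x - y\<bar>"
    and [measurable]: "q \<in> borel_measurable borel" and q: "\<And>\<xi>. 0 \<le> q \<xi>" "\<And>\<xi>. q \<xi> \<le> B"
    and s0: "0 < s0"
  defines "H \<equiv> \<lambda>s. LINT \<xi>|lborel. \<psi> (s * norm \<xi>) * q \<xi>"
    and "c \<equiv> D * (2 + 4 / s0) * measure lborel (cball (0::real^3) (4 / s0))"
  shows "H field_differentiable at s0"
    and "s0 / 2 < s \<Longrightarrow> \<bar>H s\<bar> \<le> c * B"
    and "s0 / 2 < s \<Longrightarrow> \<bar>H s - H s0\<bar> \<le> c * B * \<bar>s - s0\<bar>"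
proof -
  have sm: "smooth \<psi>" and supp: "\<And>r. r \<notin> {1/2..2} \<Longrightarrow> \<psi> r = 0"
    using assms(1) by (auto simp: bump_def)
  have [measurable]: "\<psi> \<in> borel_measurable borel"
    using borel_measurable_continuous_onI[OF continuous_on_smooth[OF sm]] .
  have B: "0 \<le> B"
    using q order_trans by blast
  let ?R = "4 / s0" and ?S = "{s0/2<..}"
  let ?I = "\<lambda>\<xi>::real^3. indicator (cball 0 ?R) \<xi> :: real"
  have I: "integrable lborel ?I"
    by (simp add: integrable_indicator_iff emeasure_bounded_finite[OF bounded_cball, unfolded infinity_ennreal_def])
  \<comment> \<open>Here \<open>s * norm \<xi>\<close> exceeds \<open>s0 / 2 * (4 / s0) = 2\<close>,
    the upper end of the support.\<close>
  have zero: "\<psi> (s * norm \<xi>) = 0" if "\<xi> \<notin> cball 0 ?R" "s0/2 < s" for \<xi> :: "real^3" and s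
  proof -
    have "s0 / 2 * ?R < s * norm \<xi>"
      using that s0 by (intro mult_strict_mono) (auto simp: field_simps)
    then show ?thesis
      using s0 by (intro supp) auto
  qed
  have bd: "\<bar>\<psi> (s * norm \<xi>) * q \<xi>\<bar> \<le> D * 2 * B * ?I \<xi>" if "s0/2 < s" for \<xi> s
  proof -
    \<comment> \<open>Comparison with \<open>\<psi> 0 = 0\<close> by the Lipschitz bound, as
      \<open>\<bar>r\<bar> \<le> 2\<close> on the support.\<close>
    have "\<bar>\<psi> r\<bar> \<le> D * 2" for r
      using D(2)[of r 0] supp[of 0] supp[of r] D(1) mult_left_mono[of "\<bar>r\<bar>" 2 D]
      by (cases "r \<in> {1/2..2}") auto
    then have "\<bar>\<psi> (s * norm \<xi>) * q \<xi>\<bar> \<le> (D * 2) * B"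
      unfolding abs_mult using q D(1) by (intro mult_mono) auto
    then show ?thesis
      using zero[OF _ that, of \<xi>] by (cases "\<xi> \<in> cball 0 ?R") auto
  qed
  have lip: "\<bar>\<psi> (s * norm \<xi>) * q \<xi> - \<psi> (s0 * norm \<xi>) * q \<xi>\<bar> \<le> D * ?R * B * ?I \<xi> * \<bar>s - s0\<bar>"
    if "s0/2 < s" for \<xi> s
  proof (cases "\<xi> \<in> cball 0 ?R")
    case True
    have "\<bar>\<psi> (s * norm \<xi>) - \<psi> (s0 * norm \<xi>)\<bar> \<le> D * \<bar>s * norm \<xi> - s0 * norm \<xi>\<bar>"
      by (rule D(2))
    also have "\<dots> = D * (norm \<xi> * \<bar>s - s0\<bar>)"
      by (simp add: left_diff_distrib[symmetric] abs_mult mult.commute)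
    also have "\<dots> \<le> D * (?R * \<bar>s - s0\<bar>)"
      using True D(1) by (intro mult_left_mono mult_right_mono) auto
    finally have "\<bar>\<psi> (s * norm \<xi>) - \<psi> (s0 * norm \<xi>)\<bar> * q \<xi> \<le> D * (?R * \<bar>s - s0\<bar>) * B"
      using q D(1) s0 by (intro mult_mono) auto
    moreover have "\<bar>\<psi> (s * norm \<xi>) * q \<xi> - \<psi> (s0 * norm \<xi>) * q \<xi>\<bar>
        = \<bar>\<psi> (s * norm \<xi>) - \<psi> (s0 * norm \<xi>)\<bar> * q \<xi>"
      using q(1)[of \<xi>] by (simp only: left_diff_distrib[symmetric] abs_mult abs_of_nonneg)
    ultimately show ?thesis
      using True by (simp add: mult_ac)
  next
    case False
    then show ?thesis
      using zero[OF False that] zero[OF False, of s0] s0 by simp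
  qed
  have int: "integrable lborel (\<lambda>\<xi>. \<psi> (s * norm \<xi>) * q \<xi>)" if "s0/2 < s" for s
  proof (rule Bochner_Integration.integrable_bound[where f = "\<lambda>\<xi>. D * 2 * B * ?I \<xi>"])
    show "AE \<xi> in lborel. norm (\<psi> (s * norm \<xi>) * q \<xi>) \<le> norm (D * 2 * B * ?I \<xi>)"
      unfolding real_norm_def by (intro AE_I2 order_trans[OF bd[OF that] abs_ge_self])
    show "integrable lborel (\<lambda>\<xi>. D * 2 * B * ?I \<xi>)"
      by (intro integrable_mult_right I)
  qed measurable
  have intI: "(LINT \<xi>|lborel. e * ?I \<xi>) = e * measure lborel (cball (0::real^3) ?R)" for e
    by simp
  show "H field_differentiable at s0"
    unfolding H_def
  proof (rule field_differentiable_integral[where S = ?S and g = "\<lambda>\<xi>. D * ?R * B * ?I \<xi>"])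
    show "(\<lambda>s. \<psi> (s * norm \<xi>) * q \<xi>) field_differentiable at s0" for \<xi>
    proof -
      have "((\<lambda>s. s * norm \<xi>) has_real_derivative norm \<xi>) (at s0)"
        by (auto intro!: derivative_eq_intros)
      from DERIV_cmult_right[OF DERIV_chain2[OF smooth_real_has_derivative[OF sm] this], of "q \<xi>"]
      show ?thesis
        unfolding field_differentiable_def by (rule exI)
    qed
    show "integrable lborel (\<lambda>\<xi>. D * ?R * B * ?I \<xi>)"
      by (intro integrable_mult_right I)
    show "\<bar>\<psi> (s * norm \<xi>) * q \<xi> - \<psi> (s0 * norm \<xi>) * q \<xi>\<bar> \<le> D * ?R * B * ?I \<xi> * \<bar>s - s0\<bar>"
      if "s \<in> ?S" for \<xi> s
      using that by (intro lip) simp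
  qed (use s0 int in simp_all)
  have c: "D * 2 * measure lborel (cball (0::real^3) ?R) \<le> c" "D * ?R * measure lborel (cball (0::real^3) ?R) \<le> c"
    unfolding c_def using D(1) s0 by (intro mult_right_mono mult_left_mono; simp)+
  {
    assume s: "s0 / 2 < s"
    have s0': "s0 / 2 < s0"
      using s0 by simp
    have "\<bar>H s\<bar> \<le> (LINT \<xi>|lborel. \<bar>\<psi> (s * norm \<xi>) * q \<xi>\<bar>)"
      unfolding H_def by (rule integral_abs_bound)
    also have "\<dots> \<le> (LINT \<xi>|lborel. D * 2 * B * ?I \<xi>)"
      by (intro integral_mono integrable_abs int[OF s] integrable_mult_right I bd[OF s])
    also have "\<dots> \<le> c * B"
      unfolding intI using mult_right_mono[OF c(1) B] by (simp add: mult_ac)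
    finally show "\<bar>H s\<bar> \<le> c * B" .
    have "H s - H s0 = (LINT \<xi>|lborel. \<psi> (s * norm \<xi>) * q \<xi> - \<psi> (s0 * norm \<xi>) * q \<xi>)"
      unfolding H_def using int[OF s] int[OF s0'] by simp
    also have "\<bar>\<dots>\<bar> \<le> (LINT \<xi>|lborel. \<bar>\<psi> (s * norm \<xi>) * q \<xi> - \<psi> (s0 * norm \<xi>) * q \<xi>\<bar>)"
      by (rule integral_abs_bound)
    also have "\<dots> \<le> (LINT \<xi>|lborel. D * ?R * B * ?I \<xi> * \<bar>s - s0\<bar>)"
      by (intro integral_mono integrable_abs Bochner_Integration.integrable_diff int[OF s] int[OF s0']
          integrable_mult_left integrable_mult_right I lip[OF s])
    also have "\<dots> = (D * ?R * measure lborel (cball (0::real^3) ?R)) * (B * \<bar>s - s0\<bar>)"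
      using intI[of "D * ?R * B"] by (simp add: mult_ac)
    also have "\<dots> \<le> c * (B * \<bar>s - s0\<bar>)"
      using B by (intro mult_right_mono c) auto
    finally show "\<bar>H s - H s0\<bar> \<le> c * B * \<bar>s - s0\<bar>"
      by (simp add: mult.assoc)
  }
qed

section \<open>The Fourier transform in terms of the field, and differentiation of the averaged
  spectrum\<close>

lemma norm_fourier_sq:
  "(norm (fourier \<Omega> f \<xi>))\<^sup>2 = (\<Sum>i\<in>UNIV. (cmod (LINT x:cell \<Omega>|lborel.
      exp (- (\<i> * complex_of_real (x \<bullet> \<xi>))) * complex_of_real (f x $ i)))\<^sup>2)"
  by (simp add: norm_vec_def L2_set_def fourier_def sum_nonneg)

lemma measurable_norm_fourier_sq:
  assumes v: "(\<lambda>(t, x). v t x) \<in> borel_measurable (lborel \<Otimes>\<^sub>M lborel)"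
  shows "(\<lambda>(t, \<xi>). (norm (fourier \<Omega> (v t) \<xi>))\<^sup>2) \<in> borel_measurable (lborel \<Otimes>\<^sub>M lborel)"
proof -
  have "(\<lambda>(p, x). indicator (cell \<Omega>) x *\<^sub>R (exp (- (\<i> * complex_of_real (x \<bullet> snd p)))
      * complex_of_real (v (fst p) x $ i))) \<in> borel_measurable ((lborel \<Otimes>\<^sub>M lborel) \<Otimes>\<^sub>M lborel)" for i
  proof -
    have "(\<lambda>(p, x). v (fst p) x) \<in> borel_measurable ((lborel \<Otimes>\<^sub>M (lborel :: (real^3) measure)) \<Otimes>\<^sub>M lborel)"
      using measurable_compose[OF _ v, of "\<lambda>(p, x). (fst p, x)" "(lborel \<Otimes>\<^sub>M (lborel :: (real^3) measure)) \<Otimes>\<^sub>M lborel"]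
      by (simp add: case_prod_beta')
    then have [measurable]: "(\<lambda>(p, x). v (fst p) x \<bullet> axis i 1)
        \<in> borel_measurable ((lborel \<Otimes>\<^sub>M (lborel :: (real^3) measure)) \<Otimes>\<^sub>M lborel)"
      by (simp add: case_prod_beta')
    then have [measurable]: "(\<lambda>p. v (fst (fst p)) (snd p) $ i)
        \<in> borel_measurable ((lborel \<Otimes>\<^sub>M (lborel :: (real^3) measure)) \<Otimes>\<^sub>M lborel)"
      by (simp add: inner_axis case_prod_beta')
    show ?thesis
      unfolding case_prod_beta' by measurable
  qed
  from lborel.borel_measurable_lebesgue_integral[OF this]
  show ?thesis
    unfolding norm_fourier_sq set_lebesgue_integral_def case_prod_beta' by measurable
qed

text \<open>Each of the three components is at most \<open>N\<close> in modulus, whence the factor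
  3; the default value 0 of a divergent integral obeys the bound as well.\<close>

lemma norm_fourier_sq_le:
  assumes "L1_norm \<Omega> f \<le> ennreal N" and N: "0 \<le> N"
  shows "(norm (fourier \<Omega> f \<xi>))\<^sup>2 \<le> 3 * N\<^sup>2"
proof -
  have "cmod (LINT x:cell \<Omega>|lborel. exp (- (\<i> * complex_of_real (x \<bullet> \<xi>))) * complex_of_real (f x $ i)) \<le> N"
    (is "cmod (LINT x:_|_. ?g x) \<le> N") for i
  proof (cases "integrable lborel (\<lambda>x. indicator (cell \<Omega>) x *\<^sub>R ?g x)")
    case True
    have "ennreal (cmod (LINT x:cell \<Omega>|lborel. ?g x))
        \<le> (\<integral>\<^sup>+x. ennreal (norm (indicator (cell \<Omega>) x *\<^sub>R ?g x)) \<partial>lborel)"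
      unfolding set_lebesgue_integral_def by (rule integral_norm_bound_ennreal[OF True])
    also have "\<dots> \<le> L1_norm \<Omega> f"
      unfolding L1_norm_def
      by (intro nn_integral_mono)
        (auto simp: indicator_def norm_mult component_le_norm_cart intro!: ennreal_leI)
    also note assms(1)
    finally show ?thesis
      using N by simp
  next
    case False
    then show ?thesis
      using N by (simp add: set_lebesgue_integral_def not_integrable_integral_eq)
  qed
  then have "(norm (fourier \<Omega> f \<xi>))\<^sup>2 \<le> (\<Sum>i\<in>(UNIV :: 3 set). N\<^sup>2)"
    unfolding norm_fourier_sq by (intro sum_mono power_mono) auto
  then show ?thesis
    by simp
qed

text \<open>The denominator of \<open>Vol\<close> is finite because the energy is essentially
  bounded in time, so an infinite numerator would make \<open>Vol\<close> infinite.\<close>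

lemma L1_norm_sq_time_integrable:
  assumes u: "u \<in> leray_space \<Omega>" and T: "0 \<le> T0" "T0 < T1" and V: "Vol \<Omega> u T0 T1 < \<infinity>"
  shows "(\<integral>\<^sup>+t\<in>{T0..T1}. (L1_norm \<Omega> (u t))\<^sup>2 \<partial>lborel) < \<infinity>"
proof -
  obtain B where B: "AE t in lborel. t \<ge> 0 \<longrightarrow> L2_norm_sq \<Omega> (u t) \<le> ennreal B"
    using u unfolding leray_space_def by blast
  have T': "ennreal (T1 - T0) \<noteq> 0"
    using T by simp
  have "(\<integral>\<^sup>+t\<in>{T0..T1}. L2_norm_sq \<Omega> (u t) \<partial>lborel) \<le> (\<integral>\<^sup>+t. ennreal B * indicator {T0..T1} t \<partial>lborel)"
    by (rule nn_integral_mono_AE, use B in eventually_elim) (use T in \<open>auto simp: indicator_def\<close>)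
  also have "\<dots> < \<infinity>"
    using T by (simp add: nn_integral_cmult_indicator ennreal_mult_less_top)
  finally have "time_avg_nn T0 T1 (\<lambda>t. L2_norm_sq \<Omega> (u t)) \<noteq> \<infinity>"
    using T T' by (auto simp: time_avg_nn_def ennreal_divide_eq_top_iff)
  then have "time_avg_nn T0 T1 (\<lambda>t. (L1_norm \<Omega> (u t))\<^sup>2) \<noteq> \<infinity>"
    using V by (auto simp: Vol_def ennreal_top_divide)
  then have "(\<integral>\<^sup>+t\<in>{T0..T1}. (L1_norm \<Omega> (u t))\<^sup>2 \<partial>lborel) \<noteq> \<infinity>"
    unfolding time_avg_nn_def by (auto simp: ennreal_top_divide)
  then show ?thesis
    by (simp add: less_top)
qed

text \<open>In the variable \<open>s = 1 / k\<close> the spectrum is a radial integral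
  \<open>H s t\<close> up to a smooth factor. It is differentiated first under the integral over
  frequencies at each time, then under the time integral, dominated by a multiple of the squared
  \<open>L1_norm\<close>.\<close>

lemma E_star_avg_field_differentiable:
  assumes "bump \<psi>" and u: "u \<in> leray_space R3" and T: "0 \<le> T0" "T0 < T1"
    and V: "Vol R3 u T0 T1 < \<infinity>" and K: "0 < K"
  shows "E_star_avg R3 \<psi> u T0 T1 field_differentiable at K"
proof -
  obtain v where v: "(\<lambda>(t, x). v t x) \<in> borel_measurable (lborel \<Otimes>\<^sub>M lborel)" "\<And>t. 0 \<le> t \<Longrightarrow> v t = u t"
    using u spacetime_measurable_extend[of u] unfolding leray_space_def by blast
  obtain D where D: "0 \<le> D" "\<And>x y. \<bar>\<psi> x - \<psi> y\<bar> \<le> D * \<bar>x - y\<bar>"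
    using bump_lipschitz[OF \<open>bump \<psi>\<close>] by blast
  have [measurable]: "\<psi> \<in> borel_measurable borel"
    using borel_measurable_continuous_onI[OF continuous_on_smooth, of \<psi>] \<open>bump \<psi>\<close> by (simp add: bump_def)
  define n where "n t = L1_norm R3 (v t)" for t
  have n_meas [measurable]: "n \<in> borel_measurable borel"
    unfolding n_def by (rule L1_norm_measurable[OF v(1)])
  have "(\<integral>\<^sup>+t. (n t)\<^sup>2 * indicator {T0..T1} t \<partial>lborel) = (\<integral>\<^sup>+t\<in>{T0..T1}. (L1_norm R3 (u t))\<^sup>2 \<partial>lborel)"
    by (intro nn_integral_cong) (use T v(2) in \<open>auto simp: n_def indicator_def\<close>)
  then have fin: "(\<integral>\<^sup>+t. (n t)\<^sup>2 * indicator {T0..T1} t \<partial>lborel) < \<infinity>"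
    using L1_norm_sq_time_integrable[OF u T V] by simp
  define A where "A = {t \<in> {T0..T1}. n t < \<infinity>}"
  have [measurable]: "A \<in> sets borel"
    unfolding A_def by measurable
  have AE_A: "AE t in lborel. t \<in> {T0..T1} \<longrightarrow> t \<in> A"
    using nn_integral_PInf_AE[of "\<lambda>t. (n t)\<^sup>2 * indicator {T0..T1} t" lborel] fin
    by (auto simp: A_def less_top power2_eq_square ennreal_mult_less_top elim!: eventually_mono)
  define N where "N t = indicator A t * (enn2real (n t))\<^sup>2" for t
  have N: "integrable lborel N"
  proof (rule integrableI_bounded)
    show "N \<in> borel_measurable lborel"
      unfolding N_def by measurable
    have "ennreal (norm (N t)) \<le> (n t)\<^sup>2 * indicator {T0..T1} t" for t
      by (cases "n t") (auto simp: N_def A_def indicator_def ennreal_power)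
    then have "(\<integral>\<^sup>+t. ennreal (norm (N t)) \<partial>lborel) \<le> (\<integral>\<^sup>+t. (n t)\<^sup>2 * indicator {T0..T1} t \<partial>lborel)"
      by (rule nn_integral_mono)
    then show "(\<integral>\<^sup>+t. ennreal (norm (N t)) \<partial>lborel) < \<infinity>"
      using fin by (rule le_less_trans)
  qed
  define q where "q t \<xi> = (norm (fourier R3 (v t) \<xi>))\<^sup>2" for t \<xi>
  have q_meas: "(\<lambda>(t, \<xi>). q t \<xi>) \<in> borel_measurable (lborel \<Otimes>\<^sub>M lborel)"
    unfolding q_def by (rule measurable_norm_fourier_sq[OF v(1)])
  have q_meas': "q t \<in> borel_measurable borel" for t
    using q_meas by measurable
  have q0: "0 \<le> q t \<xi>" for t \<xi>
    by (simp add: q_def)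
  have qN: "q t \<xi> \<le> 3 * (enn2real (n t))\<^sup>2" if "t \<in> A" for t \<xi>
    unfolding q_def using that by (intro norm_fourier_sq_le) (auto simp: A_def n_def)
  define H where "H s t = (LINT \<xi>|lborel. \<psi> (s * norm \<xi>) * q t \<xi>)" for s t
  have H_meas: "H s \<in> borel_measurable lborel" for s
  proof -
    have "(\<lambda>(t, \<xi>). \<psi> (s * norm \<xi>) * q t \<xi>) \<in> borel_measurable (lborel \<Otimes>\<^sub>M lborel)"
      using q_meas by measurable
    from lborel.borel_measurable_lebesgue_integral[OF this] show ?thesis
      unfolding H_def .
  qed
  \<comment> \<open>Only a null set of \<open>{T0..T1}\<close> lies outside \<open>A\<close>;
    cutting it off makes the bounds by \<open>N\<close> hold at every time.\<close>
  define F where "F s t = indicator A t * H s t" for s t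
  have F_meas: "F s \<in> borel_measurable lborel" for s
    unfolding F_def using H_meas by measurable
  let ?s0 = "1 / K"
  have s0: "0 < ?s0" "?s0 / 2 < ?s0"
    using K by (simp_all add: field_simps)
  define c where "c = D * (2 + 4 / ?s0) * measure lborel (cball (0::real^3) (4 / ?s0))"
  note reg = radial_integral_regular[OF \<open>bump \<psi>\<close> D q_meas' q0 qN s0(1), folded H_def c_def]
  have F_bound: "\<bar>F s t\<bar> \<le> 3 * c * N t" if "?s0 / 2 < s" for s t
    using reg(2)[OF _ that, of t] by (cases "t \<in> A") (auto simp: F_def N_def mult_ac)
  have F_diff: "(\<lambda>s. LINT t|lborel. F s t) field_differentiable at ?s0"
  proof (rule field_differentiable_integral[where S = "{?s0 / 2<..}" and g = "\<lambda>t. 3 * c * N t"])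
    show "integrable lborel (F s)" if "s \<in> {?s0 / 2<..}" for s
    proof (rule Bochner_Integration.integrable_bound[where f = "\<lambda>t. 3 * c * N t"])
      show "AE t in lborel. norm (F s t) \<le> norm (3 * c * N t)"
        using that unfolding real_norm_def by (intro AE_I2 order_trans[OF F_bound abs_ge_self]) simp
    qed (intro integrable_mult_right N F_meas)+
    show "(\<lambda>s. F s t) field_differentiable at ?s0" for t
    proof (cases "t \<in> A")
      case True
      then show ?thesis
        using reg(1)[of t] by (simp add: F_def)
    qed (simp add: F_def)
    show "\<bar>F s t - F ?s0 t\<bar> \<le> 3 * c * N t * \<bar>s - ?s0\<bar>" if "s \<in> {?s0 / 2<..}" for s t
      using reg(3)[of t s] that by (cases "t \<in> A") (auto simp: F_def N_def mult_ac)
    show "integrable lborel (\<lambda>t. 3 * c * N t)"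
      by (intro integrable_mult_right N)
  qed (use s0 in simp_all)
  have E: "E_star_avg R3 \<psi> u T0 T1 k
      = 1 / (k * (2 * pi) ^ 3 * (T1 - T0)) * (LINT t|lborel. F (1 / k) t)" for k
  proof -
    have Est: "E_star R3 \<psi> u k t = 1 / (k * (2 * pi) ^ 3) * H (1 / k) t" if "0 \<le> t" for t
      using v(2)[OF that] by (simp add: H_def q_def)
    have ind: "indicator {T0..T1} t *\<^sub>R E_star R3 \<psi> u k t
        = indicator {T0..T1} t * (1 / (k * (2 * pi) ^ 3) * H (1 / k) t)" for t
      using T Est[of t] by (auto simp: indicator_def simp del: E_star.simps)
    have "(LINT t:{T0..T1}|lborel. E_star R3 \<psi> u k t) = (LINT t|lborel. 1 / (k * (2 * pi) ^ 3) * F (1 / k) t)"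
      unfolding set_lebesgue_integral_def ind
    proof (rule integral_cong_AE)
      show "AE t in lborel. indicator {T0..T1} t * (1 / (k * (2 * pi) ^ 3) * H (1 / k) t)
          = 1 / (k * (2 * pi) ^ 3) * F (1 / k) t"
        using AE_A by eventually_elim (auto simp: F_def A_def indicator_def)
    qed (use H_meas F_meas in measurable)
    then show ?thesis
      by (simp add: E_star_avg_def time_avg_def del: E_star.simps)
  qed
  have "(\<lambda>k. LINT t|lborel. F (1 / k) t) field_differentiable at K"
  proof -
    have "(\<lambda>k. 1 / k) field_differentiable at K"
      using K by (intro field_differentiable_divide field_differentiable_const field_differentiable_ident) simp
    from field_differentiable_compose[OF this F_diff] show ?thesis
      by (simp add: comp_def)
  qed
  moreover have "(\<lambda>k. 1 / (k * (2 * pi) ^ 3 * (T1 - T0))) field_differentiable at K"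
    using K T by (intro field_differentiable_divide field_differentiable_mult field_differentiable_const field_differentiable_ident) simp
  ultimately have "(\<lambda>k. 1 / (k * (2 * pi) ^ 3 * (T1 - T0)) * (LINT t|lborel. F (1 / k) t)) field_differentiable at K"
    by (rule field_differentiable_mult[rotated])
  then show ?thesis
    unfolding E[abs_def, symmetric] .
qed

subsection \<open>Logarithmic slopes\<close>

text \<open>Mean value inequality in the variable \<open>z = ln x\<close>: the quantity in the slope
  hypothesis is the derivative of \<open>ln (E (exp z)) + s * z\<close>.\<close>

lemma log_slope_bound_interval:
  fixes E :: "real \<Rightarrow> real"
  assumes "0 < a"
    and pos: "\<And>x. x \<in> {a..b} \<Longrightarrow> 0 < E x"
    and diff: "\<And>x. x \<in> {a..b} \<Longrightarrow> E field_differentiable at x"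
    and slope: "\<And>x. x \<in> {a..b} \<Longrightarrow> \<bar>x * deriv (\<lambda>k. ln (E k)) x + s\<bar> \<le> \<gamma>"
    and x: "x \<in> {a..b}" and y: "y \<in> {a..b}"
  shows "\<bar>(ln (E x) + s * ln x) - (ln (E y) + s * ln y)\<bar> \<le> \<gamma> * \<bar>ln x - ln y\<bar>"
proof -
  have "norm ((ln (E (exp (ln x))) + s * ln x) - (ln (E (exp (ln y))) + s * ln y)) \<le> \<gamma> * norm (ln x - ln y)"
  proof (rule field_differentiable_bound[of "{ln a..ln b}" "\<lambda>z. ln (E (exp z)) + s * z"
        "\<lambda>z. exp z * deriv (\<lambda>k. ln (E k)) (exp z) + s"])
    have exp: "exp z \<in> {a..b}" if "z \<in> {ln a..ln b}" for z
    proof -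
      have "exp (ln a) \<le> exp z" "exp z \<le> exp (ln b)"
        using that by (simp_all only: exp_le_cancel_iff atLeastAtMost_iff)
      moreover have "0 < b"
        using \<open>0 < a\<close> x by auto
      ultimately show ?thesis
        using \<open>0 < a\<close> by simp
    qed
    show "((\<lambda>z. ln (E (exp z)) + s * z) has_field_derivative
        exp z * deriv (\<lambda>k. ln (E k)) (exp z) + s) (at z within {ln a..ln b})"
      if "z \<in> {ln a..ln b}" for z
    proof -
      note z = exp[OF that]
      \<comment> \<open>Differentiability and positivity of \<open>E\<close> make
        \<open>deriv\<close> the true derivative of the logarithm and not an arbitrary
        value.\<close>
      obtain E' where "(E has_real_derivative E') (at (exp z))"
        using diff[OF z] unfolding field_differentiable_def ..
      from DERIV_chain2[OF DERIV_ln[OF pos[OF z]] this]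
      have "(\<lambda>k. ln (E k)) field_differentiable at (exp z)"
        unfolding field_differentiable_def by (rule exI)
      from DERIV_add[OF DERIV_chain2[OF this[folded DERIV_deriv_iff_field_differentiable] DERIV_exp]
          DERIV_cmult_Id[of s]]
      show ?thesis
        unfolding mult.commute[of "exp z"] by (rule has_field_derivative_at_within)
    qed
    show "norm (exp z * deriv (\<lambda>k. ln (E k)) (exp z) + s) \<le> \<gamma>" if "z \<in> {ln a..ln b}" for z
      using slope[OF exp[OF that]] by simp
  qed (use x y \<open>0 < a\<close> in simp_all)
  moreover have "0 < x" "0 < y"
    using x y \<open>0 < a\<close> by auto
  ultimately show ?thesis
    by simp
qed

text \<open>Induction on the number of points of \<open>S\<close> strictly between \<open>x\<close>
  and \<open>y\<close>: splitting at one of them lowers it on both sides, and the differences of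
  \<open>h\<close> telescope. \<open>P\<close> is carried along because positivity of the spectrum,
  too, is first known only for consecutive pairs.\<close>

lemma consecutive_chain:
  fixes S :: "real set" and f h :: "real \<Rightarrow> real"
  assumes fin: "finite (S \<inter> {a..b})"
    and step: "\<And>x y. x \<in> S \<Longrightarrow> y \<in> S \<Longrightarrow> a \<le> x \<Longrightarrow> x < y \<Longrightarrow> y \<le> b \<Longrightarrow> S \<inter> {x<..<y} = {} \<Longrightarrow>
      P x \<and> P y \<and> \<bar>f y - f x\<bar> \<le> h y - h x"
  shows "x \<in> S \<Longrightarrow> y \<in> S \<Longrightarrow> a \<le> x \<Longrightarrow> x < y \<Longrightarrow> y \<le> b \<Longrightarrow> P x \<and> P y \<and> \<bar>f y - f x\<bar> \<le> h y - h x"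
proof (induction "card (S \<inter> {x<..<y})" arbitrary: x y rule: less_induct)
  case less
  show ?case
  proof (cases "S \<inter> {x<..<y} = {}")
    case True
    then show ?thesis
      using step less.prems by blast
  next
    case False
    then obtain m where m: "m \<in> S" "x < m" "m < y"
      by auto
    have fin': "finite (S \<inter> {x<..<y})"
      by (rule finite_subset[OF _ fin]) (use less.prems in auto)
    have card: "card (S \<inter> {x<..<m}) < card (S \<inter> {x<..<y})" "card (S \<inter> {m<..<y}) < card (S \<inter> {x<..<y})"
      using m by (auto intro!: psubset_card_mono[OF fin'])
    have "P x \<and> P m \<and> \<bar>f m - f x\<bar> \<le> h m - h x"
      by (rule less.hyps[OF card(1)]) (use less.prems m in simp_all)
    moreover have "P m \<and> P y \<and> \<bar>f y - f m\<bar> \<le> h y - h m"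
      by (rule less.hyps[OF card(2)]) (use less.prems m in simp_all)
    ultimately show ?thesis
      by linarith
  qed
qed

text \<open>A frequency at most \<open>b\<close> comes from a lattice vector whose three integer
  coordinates are at most \<open>b * L / (2 * pi)\<close> in modulus.\<close>

lemma finite_freqs_T3:
  assumes "L > 0"
  shows "finite (freqs (T3 L) \<inter> {a..b})"
proof -
  define M where "M = \<lceil>b * L / (2 * pi)\<rceil>"
  define g :: "(3 \<Rightarrow> int) \<Rightarrow> real^3" where "g n = (\<chi> i. 2 * pi / L * of_int (n i))" for n
  have "k \<in> g ` (UNIV \<rightarrow>\<^sub>E {-M..M})" if k: "k \<in> dual_lattice L" "norm k \<le> b" for k
  proof -
    obtain n where n: "\<And>i. k $ i = 2 * pi / L * of_int (n i)"
      using k(1) unfolding dual_lattice_def by (auto dest!: choice)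
    have "n i \<in> {-M..M}" for i
    proof -
      have "2 * pi / L * \<bar>of_int (n i)\<bar> \<le> b"
        using component_le_norm_cart[of k i] k(2) assms by (simp add: n abs_mult)
      then have "\<bar>of_int (n i)\<bar> \<le> b * L / (2 * pi)"
        using assms by (simp add: field_simps)
      from order_trans[OF this le_of_int_ceiling] have "of_int \<bar>n i\<bar> \<le> real_of_int M"
        by (simp only: M_def of_int_abs)
      then have "\<bar>n i\<bar> \<le> M"
        by (simp only: of_int_le_iff)
      then show ?thesis
        by auto
    qed
    moreover have "k = g n"
      by (simp add: g_def vec_eq_iff n)
    ultimately show ?thesis
      by auto
  qed
  then have "freqs (T3 L) \<inter> {a..b} \<subseteq> norm ` g ` (UNIV \<rightarrow>\<^sub>E {-M..M})"
    by auto
  then show ?thesis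
    by (rule finite_subset) (intro finite_imageI finite_PiE; simp)
qed

text \<open>A finite supremum bounds every term and rules out the branch \<open>\<infinity>\<close>,
  which yields positivity of the spectrum together with the slope bound.\<close>

lemma log_slope_bound_R3:
  assumes "bump \<psi>" and T: "0 \<le> T0" "T0 < T1" and u: "u \<in> leray_space R3"
    and range: "inertial_range R3 \<psi> u T0 T1 Km Kp"
    and prec: "spectral_precision R3 \<psi> u T0 T1 Km Kp = ereal \<gamma>"
    and K: "K \<in> {Km..Kp}" "K' \<in> {Km..Kp}" "K' \<le> K"
  defines "E \<equiv> E_star_avg R3 \<psi> u T0 T1"
  shows "0 < E K" and "0 < E K'"
    and "\<bar>(ln (E K) + 5/3 * ln K) - (ln (E K') + 5/3 * ln K')\<bar> \<le> \<gamma> * (ln K - ln K')"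
proof -
  have Km: "0 < Km" and low: "ennreal (Km ^ 3) * Vol R3 u T0 T1 \<le> 1"
    using range by (auto simp: inertial_range_def)
  \<comment> \<open>An infinite volume times the positive \<open>Km ^ 3\<close> would be infinite,
    not at most 1.\<close>
  have "Vol R3 u T0 T1 < \<infinity>"
    using low Km by (cases "Vol R3 u T0 T1 = \<infinity>") (auto simp: ennreal_mult_top less_top top_unique)
  note diff = E_star_avg_field_differentiable[OF \<open>bump \<psi>\<close> u T this, folded E_def]
  have "(if E k > 0 then ereal \<bar>k * deriv (\<lambda>k. ln (E k)) k + 5/3\<bar> else \<infinity>) \<le> ereal \<gamma>"
    if "k \<in> {Km..Kp}" for k
    using SUP_upper[OF that, of "\<lambda>k. if E k > 0 then ereal \<bar>k * deriv (\<lambda>k. ln (E k)) k + 5/3\<bar> else \<infinity>"] prec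
    by (simp add: E_def)
  then have *: "0 < E k \<and> \<bar>k * deriv (\<lambda>k. ln (E k)) k + 5/3\<bar> \<le> \<gamma>" if "k \<in> {Km..Kp}" for k
    using that by (fastforce split: if_splits)
  show "0 < E K" "0 < E K'"
    using * K by auto
  have "\<bar>(ln (E K) + 5/3 * ln K) - (ln (E K') + 5/3 * ln K')\<bar> \<le> \<gamma> * \<bar>ln K - ln K'\<bar>"
    by (rule log_slope_bound_interval[OF Km _ _ _ K(1,2)]) (use * diff Km in auto)
  then show "\<bar>(ln (E K) + 5/3 * ln K) - (ln (E K') + 5/3 * ln K')\<bar> \<le> \<gamma> * (ln K - ln K')"
    using K Km by simp
qed

text \<open>For consecutive frequencies the precision bounds a difference quotient in
  \<open>ln K\<close>; clearing its positive denominator gives the increment required by the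
  chain.\<close>

lemma log_slope_bound_T3:
  assumes L: "L > 0" and Km: "0 < Km"
    and prec: "spectral_precision (T3 L) \<psi> u T0 T1 Km Kp = ereal \<gamma>"
    and K: "K \<in> freqs (T3 L)" "K' \<in> freqs (T3 L)" "Km \<le> K'" "K' < K" "K \<le> Kp"
  defines "E \<equiv> E_star_avg (T3 L) \<psi> u T0 T1"
  shows "0 < E K' \<and> 0 < E K \<and>
    \<bar>(ln (E K) + 5/3 * ln K) - (ln (E K') + 5/3 * ln K')\<bar> \<le> \<gamma> * ln K - \<gamma> * ln K'"
proof (rule consecutive_chain[where P = "\<lambda>K. 0 < E K" and f = "\<lambda>K. ln (E K) + 5/3 * ln K"
      and h = "\<lambda>K. \<gamma> * ln K", OF finite_freqs_T3[OF L, of Km Kp] _ K(2,1,3,4,5)])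
  fix x y
  assume xy: "x \<in> freqs (T3 L)" "y \<in> freqs (T3 L)" "Km \<le> x" "x < y" "y \<le> Kp"
    "freqs (T3 L) \<inter> {x<..<y} = {}"
  have E: "E_dagger_avg (T3 L) u T0 T1 = E"
  proof
    have "E_star (T3 L) \<psi> u K = E_dagger (T3 L) u K" for K
      by (rule ext) simp
    then show "E_dagger_avg (T3 L) u T0 T1 K = E K" for K
      by (simp only: E_def E_dagger_avg_def E_star_avg_def)
  qed
  have "(x, y) \<in> {(K, K'). K \<in> freqs (T3 L) \<and> K' \<in> freqs (T3 L) \<and>
      Km \<le> K \<and> K < K' \<and> K' \<le> Kp \<and> freqs (T3 L) \<inter> {K<..<K'} = {}}"
    using xy by blast
  from SUP_upper[OF this, of "\<lambda>(K, K'). if E K > 0 \<and> E K' > 0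
      then ereal \<bar>ln (E K' / E K) / ln (K' / K) + 5/3\<bar> else \<infinity>"] prec
  have "(if E x > 0 \<and> E y > 0 then ereal \<bar>ln (E y / E x) / ln (y / x) + 5/3\<bar> else \<infinity>) \<le> ereal \<gamma>"
    unfolding spectral_precision.simps E by simp
  then have pos: "E x > 0" "E y > 0" and le: "\<bar>ln (E y / E x) / ln (y / x) + 5/3\<bar> \<le> \<gamma>"
    by (auto split: if_splits)
  have ln: "ln (y / x) = ln y - ln x" "0 < ln y - ln x" "ln (E y / E x) = ln (E y) - ln (E x)"
    using xy Km pos by (auto simp: ln_div)
  have "\<bar>(ln (E y) + 5/3 * ln y) - (ln (E x) + 5/3 * ln x)\<bar>
      = \<bar>ln (E y / E x) / ln (y / x) + 5/3\<bar> * (ln y - ln x)"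
  proof -
    have "(ln (E y) + 5/3 * ln y) - (ln (E x) + 5/3 * ln x)
        = (ln (E y / E x) / ln (y / x) + 5/3) * (ln y - ln x)"
      unfolding ln(1,3) distrib_right using ln(2) by simp
    then show ?thesis
      using ln(2) by (simp only: abs_mult abs_of_pos)
  qed
  also have "\<dots> \<le> \<gamma> * (ln y - ln x)"
    using le ln(2) by (intro mult_right_mono) auto
  finally show "0 < E x \<and> 0 < E y \<and> \<bar>(ln (E y) + 5/3 * ln y) - (ln (E x) + 5/3 * ln x)\<bar> \<le> \<gamma> * ln y - \<gamma> * ln x"
    using pos by (simp add: right_diff_distrib)
qed

section \<open>From the slope bound to the ratio of values of \<open>alpha\<close>\<close>

lemma alpha_ratio_bounds:
  fixes \<psi> :: "real \<Rightarrow> real"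
  assumes "0 < Km" "Km < Kp" "0 < K" "0 < K'"
    and \<epsilon>: "0 < time_avg T0 T1 (dissipation \<Omega> \<nu> u)"
  defines "E \<equiv> E_star_avg \<Omega> \<psi> u T0 T1"
  assumes E: "0 < E K" "0 < E K'"
    and le: "\<bar>(ln (E K) + 5/3 * ln K) - (ln (E K') + 5/3 * ln K')\<bar> \<le> \<gamma> * (ln Kp - ln Km)"
  shows "spectral_reynolds Km Kp powr (- (3 * \<gamma> / 4)) \<le> alpha \<Omega> \<nu> \<psi> u T0 T1 K / alpha \<Omega> \<nu> \<psi> u T0 T1 K' \<and>
    alpha \<Omega> \<nu> \<psi> u T0 T1 K / alpha \<Omega> \<nu> \<psi> u T0 T1 K' \<le> spectral_reynolds Km Kp powr (3 * \<gamma> / 4)"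
proof -
  let ?c = "time_avg T0 T1 (dissipation \<Omega> \<nu> u) powr (2/3)"
  have \<alpha>: "alpha \<Omega> \<nu> \<psi> u T0 T1 k = exp (ln (E k) + 5/3 * ln k) / ?c" if "0 < k" "0 < E k" for k
  proof -
    have "exp (ln (E k) + 5/3 * ln k) = E k * k powr (5/3)"
      using that by (simp add: exp_add powr_def)
    moreover have "k powr (-5/3) = 1 / k powr (5/3)"
      using powr_minus_divide[of k "5/3"] by simp
    ultimately show ?thesis
      by (simp add: alpha_def E_def)
  qed
  \<comment> \<open>The dissipation factor \<open>?c\<close> cancels because it is positive; were it
    0, both values of \<open>alpha\<close> would be 0.\<close>
  have ratio: "alpha \<Omega> \<nu> \<psi> u T0 T1 K / alpha \<Omega> \<nu> \<psi> u T0 T1 K'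
      = exp ((ln (E K) + 5/3 * ln K) - (ln (E K') + 5/3 * ln K'))"
    using assms(3,4) E \<epsilon> by (simp add: \<alpha> exp_diff)
  \<comment> \<open>The exponents \<open>4/3\<close> and \<open>3/4\<close> cancel. Taking
    \<open>s\<close> to be \<open>\<gamma>\<close> and \<open>- \<gamma>\<close> gives the two
    bounds.\<close>
  have Re: "spectral_reynolds Km Kp powr (3 * s / 4) = exp (s * (ln Kp - ln Km))" for s
    using assms(1,2) by (simp add: spectral_reynolds_def powr_powr powr_def ln_div)
  show ?thesis
    using le Re[of \<gamma>] Re[of "- \<gamma>"] unfolding ratio by (simp add: abs_le_iff)
qed

theorem proposition5:
  fixes \<Omega> :: flow_domain and \<nu> :: real and \<psi> :: "real \<Rightarrow> real"
    and u :: "real \<Rightarrow> real^3 \<Rightarrow> real^3" and T0 T1 Km Kp \<gamma> :: real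
  assumes "\<Omega> = R3 \<or> (\<exists>L>0. \<Omega> = T3 L)"
    and "\<nu> > 0" and "bump \<psi>"
    and "0 \<le> T0" and "T0 < T1"
    and "K41_function \<Omega> u T0 T1"
    and "inertial_range \<Omega> \<psi> u T0 T1 Km Kp"
    and "spectral_precision \<Omega> \<psi> u T0 T1 Km Kp = ereal \<gamma>"
  shows "\<forall>K\<in>freqs \<Omega> \<inter> {Km..Kp}. \<forall>K'\<in>freqs \<Omega> \<inter> {Km..Kp}.
           spectral_reynolds Km Kp powr (- (3 * \<gamma> / 4))
             \<le> alpha \<Omega> \<nu> \<psi> u T0 T1 K / alpha \<Omega> \<nu> \<psi> u T0 T1 K' \<and>
           alpha \<Omega> \<nu> \<psi> u T0 T1 K / alpha \<Omega> \<nu> \<psi> u T0 T1 K'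
             \<le> spectral_reynolds Km Kp powr (3 * \<gamma> / 4)"
proof (intro ballI)
  fix K K'
  assume K: "K \<in> freqs \<Omega> \<inter> {Km..Kp}" and K': "K' \<in> freqs \<Omega> \<inter> {Km..Kp}"
  have ends: "Km \<in> freqs \<Omega>" "Kp \<in> freqs \<Omega>" "0 < Km" "Km < Kp"
    using assms(7) by (auto simp: inertial_range_def)
  have u: "u \<in> leray_space \<Omega>"
    using assms(6) by (simp add: K41_function_def)
  let ?E = "E_star_avg \<Omega> \<psi> u T0 T1"
  let ?f = "\<lambda>k. ln (?E k) + 5/3 * ln k"
  have slope: "0 < ?E x \<and> 0 < ?E y \<and> \<bar>?f y - ?f x\<bar> \<le> \<gamma> * (ln y - ln x)"
    if "x \<in> freqs \<Omega>" "y \<in> freqs \<Omega>" "Km \<le> x" "x < y" "y \<le> Kp" for x y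
  proof (cases \<Omega>)
    case R3
    then show ?thesis
      using log_slope_bound_R3[of \<psi> T0 T1 u Km Kp \<gamma> y x] assms(3,4,5,7,8) u that by simp
  next
    case (T3 L)
    then show ?thesis
      using log_slope_bound_T3[of L Km \<psi> u T0 T1 Kp \<gamma> y x] assms(1,8) ends(3) that
      by (simp add: right_diff_distrib)
  qed
  \<comment> \<open>Each point of the range belongs to a nondegenerate pair: with \<open>Kp\<close>
    if it lies below it, with \<open>Km\<close> otherwise.\<close>
  have pos: "0 < ?E k" if "k \<in> freqs \<Omega> \<inter> {Km..Kp}" for k
    using slope[of k Kp] slope[of Km k] that ends by (cases "k < Kp") auto
  \<comment> \<open>The sign of \<open>\<gamma>\<close> is not assumed; it follows from the slope
    bound across the whole range. It allows the passage from \<open>{x..y}\<close> to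
    \<open>{Km..Kp}\<close> and settles the case \<open>K = K'\<close>.\<close>
  have "0 \<le> \<gamma> * (ln Kp - ln Km)"
    using slope[OF ends(1,2)] ends(4) by (meson abs_ge_zero order_refl order_trans)
  moreover have "0 < ln Kp - ln Km"
    using ends(3,4) by simp
  ultimately have \<gamma>: "0 \<le> \<gamma>"
    by (simp add: zero_le_mult_iff)
  have ordered: "\<bar>?f y - ?f x\<bar> \<le> \<gamma> * (ln Kp - ln Km)"
    if "x \<in> freqs \<Omega> \<inter> {Km..Kp}" "y \<in> freqs \<Omega> \<inter> {Km..Kp}" "x < y" for x y
  proof -
    have "ln y - ln x \<le> ln Kp - ln Km"
      using that ends(3) by (intro diff_mono) auto
    then have "\<gamma> * (ln y - ln x) \<le> \<gamma> * (ln Kp - ln Km)"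
      using \<gamma> by (rule mult_left_mono)
    then show ?thesis
      using slope[of x y] that by auto
  qed
  have "\<bar>?f K - ?f K'\<bar> \<le> \<gamma> * (ln Kp - ln Km)"
    using ordered[OF K K'] ordered[OF K' K] \<open>0 \<le> \<gamma> * (ln Kp - ln Km)\<close>
    by (cases K K' rule: linorder_cases) auto
  moreover have "0 < time_avg T0 T1 (dissipation \<Omega> \<nu> u)"
    using time_avg_dissipation_pos[OF assms(1-5) u _ pos[OF K]] K by blast
  ultimately show "spectral_reynolds Km Kp powr (- (3 * \<gamma> / 4))
        \<le> alpha \<Omega> \<nu> \<psi> u T0 T1 K / alpha \<Omega> \<nu> \<psi> u T0 T1 K' \<and>
      alpha \<Omega> \<nu> \<psi> u T0 T1 K / alpha \<Omega> \<nu> \<psi> u T0 T1 K' \<le> spectral_reynolds Km Kp powr (3 * \<gamma> / 4)"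
    using K K' ends pos by (intro alpha_ratio_bounds) auto
qed

end
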